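(* Let $0<\theta<1$, let $\phi_1,\dots,\phi_N$ be finite Blaschke products with $\phi_j(0)=0$, put $\lambda_j:=\phi_j'(0)$, and assume that $|\lambda_j|<1$ for all $1\le j\le N$. Then the joint spectral radius of $\{\mathcal{L}_1,\dots,\mathcal{L}_N\}$, $$\rho:=\lim_{n\to\infty}\ \max_{|a|=n}\ \|\mathcal{L}^{a}\|^{1/n}_{\mathcal{H}^{0}_{\theta^{-1}}\to\mathcal{H}^{0}_{\theta^{-1}}},$$ equals $$\rho=\max_{1\le j\le N}|\lambda_j|.$$ If moreover $\lambda_j=0$ for all $j$, so that $\rho=0$, then every non-commutative polynomial in $\mathcal{L}_1,\dots,\mathcal{L}_N$ with zero constant term is quasi-nilpotent on $\mathcal{H}^{0}_{\theta^{-1}}$; that is, $\mathcal{L}_1,\dots,\mathcal{L}_N$ generate a quasi-nilpotent non-unital algebra.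
   Context: $\mathbb{S}^1=\{|z|=1\}$. A finite Blaschke product is a map $\phi(z)=e^{i\psi}\prod_{i=1}^q\frac{z-\lambda_i}{1-\overline{\lambda_i}z}$ with $\psi\in[0,2\pi)$, $|\lambda_i|<1$, $q\ge1$. For $0<\theta<1$ the space of hyperfunctions $\mathcal{H}_{\theta^{-1}}$ is the closure (completion) of the linear combinations of $z^k$, $k\in\mathbb{Z}$, with respect to $\|f\|_{\theta^{-1}}=\sqrt{\sum_{k\in\mathbb{Z}}|f_k|^2\theta^{2|k|}}$, where $f_k$ are the Fourier coefficients of $f$; $\mathcal{H}^0_{\theta^{-1}}$ is the subspace of those $f$ with $f_0=0$. $\mathbb{F}_N^+$ is the free semigroup of words $a=i_1i_2\dots i_n$ in the letters $1,\dots,N$, with length $|a|=n$, and $\tau(a)=\phi_{i_n}\circ\dots\circ\phi_{i_1}$. $\mathcal{L}^a$ is the Koopman operator $\mathcal{L}^af=f\circ\tau(a)$, regarded as the bounded operator on $\mathcal{H}_{\theta^{-1}}$ (and, by restriction, on its invariant subspace $\mathcal{H}^0_{\theta^{-1}}$) obtained by continuous extension from trigonometric polynomials; $\mathcal{L}_j f=f\circ\phi_j$ is the operator of the one-letter word $j$. Thus $\mathcal{L}^a=\mathcal{L}_{i_1}\cdots\mathcal{L}_{i_n}$. A bounded operator is quasi-nilpotent if its spectral radius is zero; an algebra of operators is quasi-nilpotent if each of its elements is. *)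

theory Defs
  imports "HOL-Analysis.Analysis"
begin

text \<open>Only the values on the closed unit disc are prescribed, so that nothing depends on the
  convention for division by zero at the poles.\<close>

definition finite_blaschke :: "(complex \<Rightarrow> complex) \<Rightarrow> bool" where
  "finite_blaschke \<phi> \<longleftrightarrow>
     (\<exists>\<psi>::real. \<exists>q::nat. \<exists>l :: nat \<Rightarrow> complex.
        0 \<le> \<psi> \<and> \<psi> < 2 * pi \<and> 1 \<le> q \<and> (\<forall>i\<in>{1..q}. cmod (l i) < 1) \<and>
        (\<forall>z\<in>cball 0 1. \<phi> z = cis \<psi> * (\<Prod>i\<in>{1..q}. (z - l i) / (1 - cnj (l i) * z))))"


section \<open>The space of hyperfunctions\<close>

text \<open>A hyperfunction is represented by its sequence of Fourier coefficients; the completion of the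
  trigonometric polynomials is then the weighted $\ell^2$ space \<open>hyperfunctions\<close>, as shown by
  the lemmas \<open>trig_polys_dense\<close> and \<open>hyperfunctions_complete\<close> below.\<close>

definition hf_norm :: "real \<Rightarrow> (int \<Rightarrow> complex) \<Rightarrow> real" where
  "hf_norm \<theta> f = sqrt (\<Sum>\<^sub>\<infinity>k. (cmod (f k))\<^sup>2 * \<theta> ^ (2 * nat \<bar>k\<bar>))"

definition hyperfunctions :: "real \<Rightarrow> (int \<Rightarrow> complex) set" where
  "hyperfunctions \<theta> = {f. (\<lambda>k. (cmod (f k))\<^sup>2 * \<theta> ^ (2 * nat \<bar>k\<bar>)) summable_on UNIV}"

definition hyperfunctions0 :: "real \<Rightarrow> (int \<Rightarrow> complex) set" where
  "hyperfunctions0 \<theta> = {f \<in> hyperfunctions \<theta>. f 0 = 0}"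

definition trig_polys :: "(int \<Rightarrow> complex) set" where
  "trig_polys = {p. finite {k. p k \<noteq> 0}}"

definition trig_poly_eval :: "(int \<Rightarrow> complex) \<Rightarrow> complex \<Rightarrow> complex" where
  "trig_poly_eval p z = (\<Sum>k | p k \<noteq> 0. p k * z powi k)"

definition fourier_coeff :: "(complex \<Rightarrow> complex) \<Rightarrow> int \<Rightarrow> complex" where
  "fourier_coeff g k =
     integral {0..2 * pi} (\<lambda>t. g (cis t) * cis (- (of_int k * t))) / (2 * of_real pi)"

lemma trig_polys_subset: "trig_polys \<subseteq> hyperfunctions \<theta>"
proof
  fix p assume "p \<in> trig_polys"
  then have fin: "finite {k. p k \<noteq> 0}" by (simp add: trig_polys_def)
  have "(\<lambda>k. (cmod (p k))\<^sup>2 * \<theta> ^ (2 * nat \<bar>k\<bar>)) summable_on {k. p k \<noteq> 0}"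
    using fin by (rule summable_on_finite)
  then have "(\<lambda>k. (cmod (p k))\<^sup>2 * \<theta> ^ (2 * nat \<bar>k\<bar>)) summable_on UNIV"
    by (rule summable_on_cong_neutral[THEN iffD1, rotated -1]) auto
  then show "p \<in> hyperfunctions \<theta>" by (simp add: hyperfunctions_def)
qed

lemma hyperfunctions_diff:
  assumes "0 < \<theta>" "f \<in> hyperfunctions \<theta>" "g \<in> hyperfunctions \<theta>"
  shows "(\<lambda>k. f k - g k) \<in> hyperfunctions \<theta>"
proof -
  define w where "w k = \<theta> ^ (2 * nat \<bar>k\<bar>)" for k :: int
  have w: "w k \<ge> 0" for k using assms(1) by (simp add: w_def)
  have "(\<lambda>k. 2 * ((cmod (f k))\<^sup>2 * w k) + 2 * ((cmod (g k))\<^sup>2 * w k)) summable_on UNIV"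
    using assms(2,3) unfolding hyperfunctions_def w_def
    by (intro summable_on_add summable_on_cmult_right) auto
  moreover have "(cmod (f k - g k))\<^sup>2 * w k
      \<le> 2 * ((cmod (f k))\<^sup>2 * w k) + 2 * ((cmod (g k))\<^sup>2 * w k)" for k
  proof -
    have "(cmod (f k - g k))\<^sup>2 \<le> (cmod (f k) + cmod (g k))\<^sup>2"
      by (intro power_mono norm_triangle_ineq4) auto
    also have "\<dots> \<le> 2 * (cmod (f k))\<^sup>2 + 2 * (cmod (g k))\<^sup>2"
      using sum_squares_bound[of "cmod (f k)" "cmod (g k)"] by (simp add: power2_sum)
    finally show ?thesis
      using mult_right_mono[OF _ w] by (fastforce simp: algebra_simps)
  qed
  ultimately have "(\<lambda>k. (cmod (f k - g k))\<^sup>2 * w k) summable_on UNIV"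
    by (rule summable_on_comparison_test) (use w in auto)
  then show ?thesis by (simp add: hyperfunctions_def w_def)
qed

lemma trig_polys_dense:
  assumes "0 < \<theta>" "f \<in> hyperfunctions \<theta>" "0 < \<epsilon>"
  shows "\<exists>p\<in>trig_polys. hf_norm \<theta> (\<lambda>k. f k - p k) < \<epsilon>"
proof -
  define h where "h k = (cmod (f k))\<^sup>2 * \<theta> ^ (2 * nat \<bar>k\<bar>)" for k :: int
  have sm: "h summable_on UNIV" using assms(2) by (simp add: hyperfunctions_def h_def [abs_def])
  obtain A where A: "finite A" "dist (sum h A) (infsum h UNIV) \<le> \<epsilon>\<^sup>2 / 2"
    using infsum_finite_approximation[OF sm, of "\<epsilon>\<^sup>2 / 2"] assms(3) by auto
  define p where "p k = (if k \<in> A then f k else 0)" for k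
  have p: "p \<in> trig_polys"
    using A(1) by (auto simp: trig_polys_def p_def intro: finite_subset[of _ A])
  have smA: "h summable_on (-A)" by (rule summable_on_subset_banach[OF sm]) auto
  have "infsum h UNIV = infsum h (A \<union> (-A))" by simp
  also have "\<dots> = infsum h A + infsum h (-A)"
    using A(1) smA by (intro infsum_Un_disjoint) auto
  finally have "infsum h (-A) \<le> \<epsilon>\<^sup>2 / 2" using A by (simp add: dist_real_def)
  moreover have "(\<Sum>\<^sub>\<infinity>k. (cmod (f k - p k))\<^sup>2 * \<theta> ^ (2 * nat \<bar>k\<bar>)) = infsum h (-A)"
    by (rule infsum_cong_neutral) (auto simp: p_def h_def)
  moreover have "\<epsilon>\<^sup>2 / 2 < \<epsilon>\<^sup>2" using assms(3) by simp
  ultimately have "(\<Sum>\<^sub>\<infinity>k. (cmod (f k - p k))\<^sup>2 * \<theta> ^ (2 * nat \<bar>k\<bar>)) < \<epsilon>\<^sup>2" by linarith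
  then have "hf_norm \<theta> (\<lambda>k. f k - p k) < \<epsilon>"
    unfolding hf_norm_def using assms(3) by (intro real_less_lsqrt) auto
  with p show ?thesis by blast
qed

lemma hyperfunctions_complete:
  assumes \<theta>: "0 < \<theta>" and F: "\<And>n::nat. F n \<in> hyperfunctions \<theta>"
    and Cau: "\<And>\<epsilon>. 0 < \<epsilon> \<Longrightarrow> \<exists>M. \<forall>m\<ge>M. \<forall>n\<ge>M. hf_norm \<theta> (\<lambda>k. F m k - F n k) < \<epsilon>"
  shows "\<exists>f\<in>hyperfunctions \<theta>. (\<lambda>n. hf_norm \<theta> (\<lambda>k. F n k - f k)) \<longlonglongrightarrow> 0"
proof -
  define w where "w k = \<theta> ^ (2 * nat \<bar>k\<bar>)" for k :: int
  have w: "w k > 0" for k using \<theta> by (simp add: w_def)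
  have fin: "(\<Sum>k\<in>A. (cmod (g k))\<^sup>2 * w k) \<le> (hf_norm \<theta> g)\<^sup>2"
    if "g \<in> hyperfunctions \<theta>" "finite A" for g A
  proof -
    have "(\<Sum>k\<in>A. (cmod (g k))\<^sup>2 * w k) \<le> (\<Sum>\<^sub>\<infinity>k. (cmod (g k))\<^sup>2 * w k)"
      using that w unfolding hyperfunctions_def w_def
      by (intro finite_sum_le_infsum) (auto simp: less_imp_le)
    moreover have "0 \<le> (\<Sum>\<^sub>\<infinity>k. (cmod (g k))\<^sup>2 * w k)"
      by (intro infsum_nonneg) (simp add: less_imp_le[OF w])
    ultimately show ?thesis by (simp add: hf_norm_def w_def)
  qed
  have D: "(\<lambda>k. F m k - F n k) \<in> hyperfunctions \<theta>" for m n
    using hyperfunctions_diff[OF \<theta> F F] .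
  have nn: "hf_norm \<theta> g \<ge> 0" for g
    unfolding hf_norm_def using \<theta> by (intro real_sqrt_ge_zero infsum_nonneg) auto
  have "Cauchy (\<lambda>n. F n k)" for k
  proof (rule metric_CauchyI)
    fix e :: real assume e: "0 < e"
    then obtain M where M: "\<forall>m\<ge>M. \<forall>n\<ge>M. hf_norm \<theta> (\<lambda>k. F m k - F n k) < e * sqrt (w k)"
      using Cau[of "e * sqrt (w k)"] w[of k] by auto
    have "dist (F m k) (F n k) < e" if "m \<ge> M" "n \<ge> M" for m n
    proof -
      have "(cmod (F m k - F n k) * sqrt (w k))\<^sup>2 \<le> (hf_norm \<theta> (\<lambda>k. F m k - F n k))\<^sup>2"
        using fin[OF D, of "{k}" m n] w[of k] by (simp add: power_mult_distrib)
      then have "cmod (F m k - F n k) * sqrt (w k) \<le> hf_norm \<theta> (\<lambda>k. F m k - F n k)"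
        by (rule power2_le_imp_le) (rule nn)
      also have "\<dots> < e * sqrt (w k)" using M that by blast
      finally show ?thesis using w[of k] by (simp add: dist_norm)
    qed
    then show "\<exists>M. \<forall>m\<ge>M. \<forall>n\<ge>M. dist (F m k) (F n k) < e" by blast
  qed
  then have "\<exists>l. (\<lambda>n. F n k) \<longlonglongrightarrow> l" for k using Cauchy_convergent_iff convergent_def by blast
  then obtain f where f: "\<And>k. (\<lambda>n. F n k) \<longlonglongrightarrow> f k" by metis
  have key: "\<exists>M. \<forall>n\<ge>M. \<forall>A. finite A \<longrightarrow> (\<Sum>k\<in>A. (cmod (F n k - f k))\<^sup>2 * w k) \<le> e\<^sup>2"
    if e: "0 < e" for e :: real
  proof -
    obtain M where M: "\<forall>m\<ge>M. \<forall>n\<ge>M. hf_norm \<theta> (\<lambda>k. F m k - F n k) < e"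
      using Cau[OF e] by auto
    have "(\<Sum>k\<in>A. (cmod (F n k - f k))\<^sup>2 * w k) \<le> e\<^sup>2" if "n \<ge> M" "finite A" for n A
    proof (rule tendsto_upperbound)
      show "(\<lambda>m. \<Sum>k\<in>A. (cmod (F n k - F m k))\<^sup>2 * w k)
              \<longlonglongrightarrow> (\<Sum>k\<in>A. (cmod (F n k - f k))\<^sup>2 * w k)"
        by (intro tendsto_intros f)
      have "(\<Sum>k\<in>A. (cmod (F n k - F m k))\<^sup>2 * w k) \<le> e\<^sup>2" if "m \<ge> M" for m
        using fin[OF D \<open>finite A\<close>, of n m] M \<open>n \<ge> M\<close> that
          power_mono[OF less_imp_le nn, of "\<lambda>k. F n k - F m k" e 2] by fastforce
      then show "\<forall>\<^sub>F m in sequentially. (\<Sum>k\<in>A. (cmod (F n k - F m k))\<^sup>2 * w k) \<le> e\<^sup>2"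
        using eventually_sequentially by blast
    qed simp
    then show ?thesis by blast
  qed
  have mem: "(\<lambda>k. F n k - f k) \<in> hyperfunctions \<theta> \<and> hf_norm \<theta> (\<lambda>k. F n k - f k) \<le> e"
    if n: "\<forall>A. finite A \<longrightarrow> (\<Sum>k\<in>A. (cmod (F n k - f k))\<^sup>2 * w k) \<le> e\<^sup>2" and e: "0 < e" for n e
  proof -
    have s: "(\<lambda>k. (cmod (F n k - f k))\<^sup>2 * w k) summable_on UNIV"
      using n w by (intro nonneg_bdd_above_summable_on) (auto simp: less_imp_le intro!: bdd_aboveI)
    moreover have "(\<Sum>\<^sub>\<infinity>k. (cmod (F n k - f k))\<^sup>2 * w k) \<le> e\<^sup>2"
      using n s by (intro infsum_le_finite_sums) auto
    ultimately show ?thesis using e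
      unfolding hyperfunctions_def hf_norm_def w_def by (auto intro: real_le_lsqrt)
  qed
  obtain M where "\<forall>n\<ge>M. \<forall>A. finite A \<longrightarrow> (\<Sum>k\<in>A. (cmod (F n k - f k))\<^sup>2 * w k) \<le> 1\<^sup>2"
    using key[of 1] by auto
  then have "(\<lambda>k. F M k - f k) \<in> hyperfunctions \<theta>" using mem[of M 1] by auto
  from hyperfunctions_diff[OF \<theta> F[of M] this] have "f \<in> hyperfunctions \<theta>" by simp
  moreover have "(\<lambda>n. hf_norm \<theta> (\<lambda>k. F n k - f k)) \<longlonglongrightarrow> 0"
  proof (rule LIMSEQ_I)
    fix r :: real assume r: "0 < r"
    obtain M where "\<forall>n\<ge>M. \<forall>A. finite A \<longrightarrow> (\<Sum>k\<in>A. (cmod (F n k - f k))\<^sup>2 * w k) \<le> (r/2)\<^sup>2"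
      using key[of "r/2"] r by auto
    then have "\<forall>n\<ge>M. hf_norm \<theta> (\<lambda>k. F n k - f k) \<le> r/2" using mem[of _ "r/2"] r by auto
    then show "\<exists>M. \<forall>n\<ge>M. norm (hf_norm \<theta> (\<lambda>k. F n k - f k) - 0) < r"
      using nn r by (intro exI[of _ M]) fastforce
  qed
  ultimately show ?thesis by blast
qed


section \<open>Operators\<close>

text \<open>Operators are functions on all coefficient sequences, of which only the behaviour on a
  subspace \<open>V\<close> of \<open>hyperfunctions \<theta>\<close> is considered; this is also how restriction to an invariant
  subspace is expressed.\<close>

type_synonym hf_op = "(int \<Rightarrow> complex) \<Rightarrow> (int \<Rightarrow> complex)"

definition bounded_op :: "real \<Rightarrow> (int \<Rightarrow> complex) set \<Rightarrow> hf_op \<Rightarrow> bool" where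
  "bounded_op \<theta> V T \<longleftrightarrow>
     (\<forall>f\<in>V. T f \<in> V) \<and>
     (\<forall>f\<in>V. \<forall>g\<in>V. T (\<lambda>k. f k + g k) = (\<lambda>k. T f k + T g k)) \<and>
     (\<forall>c. \<forall>f\<in>V. T (\<lambda>k. c * f k) = (\<lambda>k. c * T f k)) \<and>
     (\<exists>C. \<forall>f\<in>V. hf_norm \<theta> (T f) \<le> C * hf_norm \<theta> f)"

definition op_norm :: "real \<Rightarrow> (int \<Rightarrow> complex) set \<Rightarrow> hf_op \<Rightarrow> real" where
  "op_norm \<theta> V T = (SUP f\<in>{f\<in>V. hf_norm \<theta> f \<le> 1}. hf_norm \<theta> (T f))"

definition op_spectrum :: "real \<Rightarrow> (int \<Rightarrow> complex) set \<Rightarrow> hf_op \<Rightarrow> complex set" where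
  "op_spectrum \<theta> V T =
     {\<mu>. \<not> (\<exists>S. bounded_op \<theta> V S \<and>
             (\<forall>f\<in>V. S (\<lambda>k. T f k - \<mu> * f k) = f) \<and>
             (\<forall>f\<in>V. (\<lambda>k. T (S f) k - \<mu> * S f k) = f))}"

definition op_spectral_radius :: "real \<Rightarrow> (int \<Rightarrow> complex) set \<Rightarrow> hf_op \<Rightarrow> real" where
  "op_spectral_radius \<theta> V T = (SUP \<mu>\<in>op_spectrum \<theta> V T. cmod \<mu>)"

definition quasi_nilpotent :: "real \<Rightarrow> (int \<Rightarrow> complex) set \<Rightarrow> hf_op \<Rightarrow> bool" where
  "quasi_nilpotent \<theta> V T \<longleftrightarrow> bounded_op \<theta> V T \<and> op_spectral_radius \<theta> V T = 0"

text \<open>The continuous extension of \<open>p \<mapsto> p \<circ> \<phi>\<close> from trigonometric polynomials. It is unique if it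
  exists, by density of \<open>trig_polys\<close>; \<open>extensional\<close> only fixes the irrelevant values outside
  \<open>hyperfunctions \<theta>\<close>.\<close>

definition koopman :: "real \<Rightarrow> (complex \<Rightarrow> complex) \<Rightarrow> hf_op" where
  "koopman \<theta> \<phi> =
     (THE T. bounded_op \<theta> (hyperfunctions \<theta>) T \<and> T \<in> extensional (hyperfunctions \<theta>) \<and>
        (\<forall>p\<in>trig_polys. T p = fourier_coeff (\<lambda>z. trig_poly_eval p (\<phi> z))))"


section \<open>Words and non-commutative polynomials\<close>

definition words :: "nat \<Rightarrow> nat \<Rightarrow> nat list set" where
  "words N n = {a. length a = n \<and> set a \<subseteq> {1..N}}"

text \<open>For \<open>a = [i\<^sub>1, \<dots>, i\<^sub>n]\<close>, this is \<open>\<phi> i\<^sub>n \<circ> \<dots> \<circ> \<phi> i\<^sub>1\<close>.\<close>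

definition word_map :: "(nat \<Rightarrow> complex \<Rightarrow> complex) \<Rightarrow> nat list \<Rightarrow> complex \<Rightarrow> complex" where
  "word_map \<phi> a = fold (\<lambda>i g. \<phi> i \<circ> g) a id"

text \<open>\<open>c\<close> assigns a coefficient to every word; \<open>foldr L [i\<^sub>1, \<dots>, i\<^sub>n]\<close> is the product
  \<open>L i\<^sub>1 \<circ> \<dots> \<circ> L i\<^sub>n\<close>.\<close>

definition nc_poly_without_const :: "nat \<Rightarrow> (nat list \<Rightarrow> complex) \<Rightarrow> bool" where
  "nc_poly_without_const N c \<longleftrightarrow>
     finite {a. c a \<noteq> 0} \<and> (\<forall>a. c a \<noteq> 0 \<longrightarrow> set a \<subseteq> {1..N}) \<and> c [] = 0"

definition nc_poly_eval :: "(nat \<Rightarrow> hf_op) \<Rightarrow> (nat list \<Rightarrow> complex) \<Rightarrow> hf_op" where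
  "nc_poly_eval L c f = (\<lambda>k. \<Sum>a | c a \<noteq> 0. c a * foldr L a f k)"

inductive_set generated_algebra :: "hf_op set \<Rightarrow> hf_op set" for G where
  gen: "T \<in> G \<Longrightarrow> T \<in> generated_algebra G"
| add: "S \<in> generated_algebra G \<Longrightarrow> T \<in> generated_algebra G \<Longrightarrow>
          (\<lambda>f k. S f k + T f k) \<in> generated_algebra G"
| scale: "T \<in> generated_algebra G \<Longrightarrow> (\<lambda>f k. c * T f k) \<in> generated_algebra G"
| mult: "S \<in> generated_algebra G \<Longrightarrow> T \<in> generated_algebra G \<Longrightarrow>
          S \<circ> T \<in> generated_algebra G"

end

theory Submission
  imports Defs "HOL-Complex_Analysis.Complex_Analysis"
begin

text \<open>
A composition operator is estimated by how far its symbol shrinks discs. On the analytic half of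
the space, \<open>hf_norm s\<close> is the Hardy norm of the disc of radius \<open>s\<close>, and Littlewood's subordination
principle says: if \<open>\<phi> 0 = 0\<close> and \<open>\<phi>\<close> maps the circle of radius \<open>s\<close> into the disc of radius \<open>r\<close>, then
\<open>hf_norm s (f \<circ> \<phi>) \<le> hf_norm r f\<close> (\<open>Littlewood_subordination\<close>, \<open>comp_op_bound\<close>). The antianalytic half
behaves in the same way, being the complex conjugate of the analytic one, since \<open>\<phi>\<close> is
unimodular on the unit circle.

For functions without constant term \<open>hf_norm r f \<le> r / \<theta> * hf_norm \<theta> f\<close>, so the norm of the Koopman
operator of a word is at most \<open>r / \<theta>\<close>, where \<open>r\<close> is the radius of a disc containing the image of the
disc of radius \<open>\<theta>\<close> under the composed map. The Schwarz--Pick lemma for \<open>\<phi> z / z\<close> gives such radii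
explicitly, uniformly over all words of length \<open>n\<close>: they tend to zero and the ratio of successive
radii tends to the maximal modulus \<open>L\<close> of the derivatives at the origin
(\<open>root_contraction_radius_less\<close>). This is the upper bound \<open>L\<close> for the joint spectral radius. For the
lower bound, the \<open>n\<close>-th iterate of a map with derivative \<open>\<lambda>\<close> has derivative \<open>\<lambda> ^ n\<close>, which is the
coefficient of \<open>z\<close> in the image of \<open>z\<close>.

If all derivatives vanish, then \<open>\<bar>\<phi> z\<bar> \<le> \<bar>z\<bar>\<^sup>2\<close>, and the generators satisfy
\<open>hf_norm s (T f) \<le> C * hf_norm (s\<^sup>2) f\<close> for all radii \<open>s \<le> \<theta>\<close> at once. Such estimates persist in the
generated algebra with other constants \<open>C\<close>, and iterating one of them bounds the norm of the \<open>m\<close>-th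
power by \<open>C ^ m * \<theta> ^ (2 ^ m) / \<theta>\<close>, so the Neumann series for \<open>T - \<mu>\<close> converges for every \<open>\<mu> \<noteq> 0\<close>
(\<open>superattracting_op_resolvent\<close>). Zero is in the spectrum because no image has a coefficient at \<open>z\<close>.
\<close>

\<comment> \<open>The dollar sign denotes coefficients of formal power series throughout.\<close>
unbundle no vec_syntax


section \<open>Subordination for power series\<close>

lemma roots_of_unity_orthogonal:
  fixes n k M :: nat
  assumes "n < M" "k < M"
  shows "(\<Sum>j<M. cis (2 * pi * real j / M) ^ n * cnj (cis (2 * pi * real j / M) ^ k))
         = (if n = k then of_nat M else 0)"
proof -
  define \<zeta> where "\<zeta> = cis (2 * pi * n / M) * cnj (cis (2 * pi * k / M))"
  have M: "M > 0" using assms by simp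
  have 1: "cis (2 * pi * j / M) ^ n * cnj (cis (2 * pi * j / M) ^ k) = \<zeta> ^ j" for j :: nat
    by (simp only: \<zeta>_def cis_cnj Complex.DeMoivre cis_mult complex_cnj_power)
      (rule arg_cong[of _ _ cis], simp add: field_simps)
  have 2: "\<zeta> ^ M = 1"
  proof -
    have "\<zeta> ^ M = cis (2 * pi * n) * cis (- (2 * pi * k))"
      using M by (simp add: \<zeta>_def power_mult_distrib cis_cnj Complex.DeMoivre)
    also have "cis (2 * pi * n) = 1" by (metis cis_multiple_2pi Ints_of_nat)
    also have "cis (- (2 * pi * k)) = 1"
      using cis_multiple_2pi[of "- real k"] by simp
    finally show ?thesis by simp
  qed
  have 3: "\<zeta> = 1 \<longleftrightarrow> n = k"
  proof -
    have "\<zeta> = cis (2 * pi * n / M) / cis (2 * pi * k / M)"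
      by (simp add: \<zeta>_def cis_cnj divide_inverse)
    then have "\<zeta> = 1 \<longleftrightarrow> cis (2 * pi * n / M) = cis (2 * pi * k / M)"
      by simp
    also have "\<dots> \<longleftrightarrow> n = k"
      using Complex.bij_betw_roots_unity[OF M] assms unfolding bij_betw_def inj_on_def by auto
    finally show ?thesis .
  qed
  show ?thesis
  proof (cases "n = k")
    case True
    then show ?thesis unfolding 1 using 3 by simp
  next
    case False
    then show ?thesis unfolding 1 using 2 3 by (simp add: geometric_sum)
  qed
qed

text \<open>Averaging over the \<open>M\<close>-th roots of unity is an exact substitute for integration over the circle
as long as the polynomial has degree below \<open>M\<close>.\<close>

lemma discrete_Parseval:
  fixes d :: "nat \<Rightarrow> complex" and M :: nat
  shows "(\<Sum>j<M. (cmod (\<Sum>n<M. d n * cis (2 * pi * real j / M) ^ n))\<^sup>2) = M * (\<Sum>n<M. (cmod (d n))\<^sup>2)"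
proof -
  let ?w = "\<lambda>j::nat. cis (2 * pi * j / M)"
  have "complex_of_real (\<Sum>j<M. (cmod (\<Sum>n<M. d n * ?w j ^ n))\<^sup>2)
      = (\<Sum>j<M. (\<Sum>n<M. d n * ?w j ^ n) * (\<Sum>k<M. cnj (d k) * cnj (?w j ^ k)))"
    by (simp add: complex_norm_square del: complex_cnj_power of_real_power)
  also have "\<dots> = (\<Sum>j<M. \<Sum>n<M. \<Sum>k<M. (d n * cnj (d k)) * (?w j ^ n * cnj (?w j ^ k)))"
    by (simp add: sum_product mult_ac)
  also have "\<dots> = (\<Sum>n<M. \<Sum>j<M. \<Sum>k<M. (d n * cnj (d k)) * (?w j ^ n * cnj (?w j ^ k)))"
    by (rule sum.swap)
  also have "\<dots> = (\<Sum>n<M. \<Sum>k<M. \<Sum>j<M. (d n * cnj (d k)) * (?w j ^ n * cnj (?w j ^ k)))"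
    by (intro sum.cong refl sum.swap)
  also have "\<dots> = (\<Sum>n<M. \<Sum>k<M. (d n * cnj (d k)) * (if n = k then of_nat M else 0))"
    unfolding sum_distrib_left[symmetric]
  proof (intro sum.cong refl, goal_cases)
    case (1 n k)
    then show ?case using roots_of_unity_orthogonal[of n M k] by simp
  qed
  also have "\<dots> = (\<Sum>n<M. of_nat M * (d n * cnj (d n)))"
    by (intro sum.cong refl) (simp add: if_distrib mult_ac cong: if_cong)
  also have "\<dots> = complex_of_real (M * (\<Sum>n<M. (cmod (d n))\<^sup>2))"
    by (simp add: complex_norm_square sum_distrib_left del: of_real_power)
  finally show ?thesis using of_real_eq_iff by blast
qed

lemma eval_fps_cutoff:
  fixes H :: "complex fps"
  shows "eval_fps (fps_cutoff K H) z = (\<Sum>n<K. H $ n * z ^ n)"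
proof -
  have "eval_fps (fps_cutoff K H) z = (\<Sum>n. fps_cutoff K H $ n * z ^ n)"
    by (simp add: eval_fps_def)
  also have "\<dots> = (\<Sum>n<K. fps_cutoff K H $ n * z ^ n)"
    by (rule suminf_finite) auto
  finally show ?thesis by simp
qed

lemma fps_conv_radius_cutoff [simp]:
  "fps_conv_radius (fps_cutoff K (H :: complex fps)) = \<infinity>"
proof -
  have "eventually (\<lambda>n. fps_nth (fps_cutoff K H) n = 0) sequentially"
    using eventually_ge_at_top[of K] by eventually_elim auto
  then have "conv_radius (fps_nth (fps_cutoff K H)) = conv_radius (\<lambda>_. 0 :: complex)"
    by (intro conv_radius_cong') (auto elim: eventually_mono)
  then show ?thesis by (simp add: fps_conv_radius_def)
qed

text \<open>On the circle \<open>\<bar>z\<bar> = s\<close> the product is pointwise at most \<open>r\<close> times the polynomial, and the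
weighted coefficient sums are mean squares over that circle. To stay with finite averages, the
product is cut off at a degree \<open>M\<close>; the price is an error \<open>tail M\<close>, which vanishes in the limit.\<close>

lemma fps_multiplier_bound:
  fixes G H :: "complex fps"
  assumes s: "0 < s" "ereal s < fps_conv_radius G"
    and G: "\<And>z. cmod z = s \<Longrightarrow> cmod (eval_fps G z) \<le> r"
  shows "(\<Sum>n<L. (cmod ((G * fps_cutoff K H) $ n))\<^sup>2 * s ^ (2 * n))
         \<le> r\<^sup>2 * (\<Sum>n<K. (cmod (H $ n))\<^sup>2 * s ^ (2 * n))"
proof -
  define P U where "P = fps_cutoff K H" and "U = G * P"
  define S where "S = (\<Sum>n<K. (cmod (H $ n))\<^sup>2 * s ^ (2 * n))"
  define tail where "tail M = (\<Sum>n. cmod (U $ (n + M)) * s ^ (n + M))" for M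
  have conv: "ereal s < fps_conv_radius U"
    using s fps_conv_radius_mult[of G P] by (simp add: U_def P_def)
  have r: "r \<ge> 0" using G[of "of_real s"] s(1) by (smt (verit) norm_ge_zero norm_of_real)
  have sm: "summable (\<lambda>n. cmod (U $ n) * s ^ n)"
    using norm_summable_fps[of "complex_of_real s" U] conv s(1)
    by (simp add: norm_mult norm_power)
  have S: "(\<Sum>n<M. (cmod (P $ n))\<^sup>2 * s ^ (2 * n)) = S" if "M \<ge> K" for M
  proof -
    have "S = (\<Sum>n<K. (cmod (P $ n))\<^sup>2 * s ^ (2 * n))" by (simp add: S_def P_def)
    also have "\<dots> = (\<Sum>n<M. (cmod (P $ n))\<^sup>2 * s ^ (2 * n))"
      using that by (intro sum.mono_neutral_left) (auto simp: P_def)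
    finally show ?thesis ..
  qed
  have bound: "(\<Sum>n<L. (cmod (U $ n))\<^sup>2 * s ^ (2 * n)) \<le> (1 + tail M) * (r\<^sup>2 * S) + (tail M + (tail M)\<^sup>2)"
    if M: "M > 0" "M \<ge> K" "M \<ge> L" for M
  proof -
    define z where "z j = complex_of_real s * cis (2 * pi * j / M)" for j :: nat
    have z: "cmod (z j) = s" for j using s(1) by (simp add: z_def norm_mult)
    have zp: "V $ n * z j ^ n = (V $ n * of_real s ^ n) * cis (2 * pi * j / M) ^ n"
      for V :: "complex fps" and j n
      by (simp add: z_def power_mult_distrib)
    have avg: "(\<Sum>j<M. (cmod (\<Sum>n<M. V $ n * z j ^ n))\<^sup>2)
             = M * (\<Sum>n<M. (cmod (V $ n))\<^sup>2 * s ^ (2 * n))" for V :: "complex fps"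
      using s(1) discrete_Parseval[where M = M and d = "\<lambda>n. V $ n * complex_of_real s ^ n"]
      by (simp add: zp norm_mult norm_power power_mult_distrib power_mult[symmetric] mult.commute[of _ 2])
    have t0: "tail M \<ge> 0" unfolding tail_def
      using s(1) sm by (intro suminf_nonneg) (auto simp: summable_iff_shift[of "\<lambda>n. cmod (U $ n) * s ^ n"])
    have pt: "(cmod (\<Sum>n<M. U $ n * z j ^ n))\<^sup>2
        \<le> (1 + tail M) * (r\<^sup>2 * (cmod (\<Sum>n<M. P $ n * z j ^ n))\<^sup>2) + (tail M + (tail M)\<^sup>2)" for j
    proof -
      have smz: "summable (\<lambda>n. U $ n * z j ^ n)"
        using summable_fps[of "z j" U] conv z by simp
      have "eval_fps U (z j) = (\<Sum>n. U $ (n + M) * z j ^ (n + M)) + (\<Sum>n<M. U $ n * z j ^ n)"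
        unfolding eval_fps_def by (rule suminf_split_initial_segment[OF smz])
      moreover have "cmod (\<Sum>n. U $ (n + M) * z j ^ (n + M)) \<le> tail M"
      proof -
        have "summable (\<lambda>n. cmod (U $ (n + M) * z j ^ (n + M)))"
          using sm summable_iff_shift[of "\<lambda>n. cmod (U $ n) * s ^ n" M] 
          by (simp add: norm_mult norm_power z)
        from summable_norm[OF this] show ?thesis by (simp add: tail_def norm_mult norm_power z)
      qed
      moreover have "eval_fps U (z j) = eval_fps G (z j) * eval_fps P (z j)"
        unfolding U_def using s(2) z by (intro eval_fps_mult) (auto simp: P_def)
      moreover have "eval_fps P (z j) = (\<Sum>n<M. P $ n * z j ^ n)"
      proof -
        have "(\<Sum>n<K. P $ n * z j ^ n) = (\<Sum>n<M. P $ n * z j ^ n)"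
          using M(2) by (intro sum.mono_neutral_left) (auto simp: P_def)
        then show ?thesis by (simp add: P_def eval_fps_cutoff)
      qed
      ultimately have "cmod (\<Sum>n<M. U $ n * z j ^ n)
          \<le> cmod (eval_fps G (z j)) * cmod (\<Sum>n<M. P $ n * z j ^ n) + tail M"
        by (smt (verit) norm_triangle_ineq4 norm_mult add_diff_cancel_left')
      also have "\<dots> \<le> r * cmod (\<Sum>n<M. P $ n * z j ^ n) + tail M"
        using G[OF z] by (simp add: mult_right_mono)
      finally have le: "cmod (\<Sum>n<M. U $ n * z j ^ n) \<le> r * cmod (\<Sum>n<M. P $ n * z j ^ n) + tail M" .
      define x where "x = r * cmod (\<Sum>n<M. P $ n * z j ^ n)"
      have "(cmod (\<Sum>n<M. U $ n * z j ^ n))\<^sup>2 \<le> (x + tail M)\<^sup>2"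
        using le by (intro power_mono) (auto simp: x_def)
      also have "\<dots> = x\<^sup>2 + tail M * (2 * x) + (tail M)\<^sup>2"
        by (simp add: power2_sum algebra_simps)
      \<comment> \<open>Absorbing the mixed term into the square keeps the bound averageable over the circle.\<close>
      also have "\<dots> \<le> x\<^sup>2 + tail M * (x\<^sup>2 + 1) + (tail M)\<^sup>2"
        using t0 sum_squares_bound[of x 1] by (intro add_mono mult_left_mono) auto
      finally show ?thesis by (simp add: x_def power_mult_distrib algebra_simps)
    qed
    have "M * (\<Sum>n<L. (cmod (U $ n))\<^sup>2 * s ^ (2 * n)) \<le> M * (\<Sum>n<M. (cmod (U $ n))\<^sup>2 * s ^ (2 * n))"
      using M(3) s(1) by (intro mult_left_mono sum_mono2) auto
    also have "\<dots> = (\<Sum>j<M. (cmod (\<Sum>n<M. U $ n * z j ^ n))\<^sup>2)"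
      by (rule avg[symmetric])
    also have "\<dots> \<le> (\<Sum>j<M. (1 + tail M) * (r\<^sup>2 * (cmod (\<Sum>n<M. P $ n * z j ^ n))\<^sup>2) + (tail M + (tail M)\<^sup>2))"
      by (intro sum_mono pt)
    also have "\<dots> = (1 + tail M) * (r\<^sup>2 * (\<Sum>j<M. (cmod (\<Sum>n<M. P $ n * z j ^ n))\<^sup>2)) + M * (tail M + (tail M)\<^sup>2)"
      by (simp add: sum.distrib sum_distrib_left)
    also have "(\<Sum>j<M. (cmod (\<Sum>n<M. P $ n * z j ^ n))\<^sup>2) = M * S"
      by (simp add: avg S[OF M(2)])
    also have "(1 + tail M) * (r\<^sup>2 * (M * S)) + M * (tail M + (tail M)\<^sup>2)
        = M * ((1 + tail M) * (r\<^sup>2 * S) + (tail M + (tail M)\<^sup>2))"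
      by (simp add: algebra_simps)
    finally show ?thesis using M(1) by simp
  qed
  have "tail \<longlonglongrightarrow> 0"
    unfolding tail_def by (rule suminf_exist_split2[OF sm])
  then have "(\<lambda>M. (1 + tail M) * (r\<^sup>2 * S) + (tail M + (tail M)\<^sup>2)) \<longlonglongrightarrow> (1 + 0) * (r\<^sup>2 * S) + (0 + 0\<^sup>2)"
    by (intro tendsto_intros)
  then have "(\<Sum>n<L. (cmod (U $ n))\<^sup>2 * s ^ (2 * n)) \<le> (1 + 0) * (r\<^sup>2 * S) + (0 + 0\<^sup>2)"
    by (rule LIMSEQ_le_const) (use bound in \<open>auto intro!: exI[of _ "Suc (max K L)"]\<close>)
  then show ?thesis by (simp add: U_def P_def S_def)
qed

text \<open>Littlewood's argument: with \<open>F = F 0 + X F'\<close> one gets \<open>F \<circ> G = F 0 + G (F' \<circ> G)\<close>, where the two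
summands are orthogonal because \<open>G\<close> has no constant term. Multiplication by \<open>G\<close> costs a factor
\<open>r\<close>, so each coefficient \<open>F k\<close> collects \<open>k\<close> such factors. The usual form of the principle is
\<open>r = s\<close>; keeping \<open>r\<close> free is what later yields decay. The sums are truncated at the same index
on both sides, so that no convergence of \<open>F\<close> is presupposed.\<close>

lemma Littlewood_subordination:
  fixes F G :: "complex fps"
  assumes s: "0 < s" "ereal s < fps_conv_radius G" and G0: "G $ 0 = 0"
    and G: "\<And>z. cmod z = s \<Longrightarrow> cmod (eval_fps G z) \<le> r"
  shows "(\<Sum>n<K. (cmod ((F oo G) $ n))\<^sup>2 * s ^ (2 * n)) \<le> (\<Sum>k<K. (cmod (F $ k))\<^sup>2 * r ^ (2 * k))"
proof (induction K arbitrary: F)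
  case 0
  then show ?case by simp
next
  case (Suc K)
  define F' H where "F' = fps_shift 1 F" and "H = F' oo G"
  have "F = fps_const (F $ 0) + fps_X * F'"
    by (rule fps_ext) (auto simp: F'_def gr0_conv_Suc)
  then have "F oo G = fps_const (F $ 0) + G * H"
    unfolding H_def by (metis G0 fps_X_fps_compose_startby0 fps_compose_add_distrib fps_compose_mult_distrib fps_const_compose)
  then have comp: "(F oo G) $ n = (if n = 0 then F $ 0 else (G * H) $ n)" for n
    using G0 by auto
  \<comment> \<open>The zero of \<open>G\<close> raises degrees by one, which is why \<open>H\<close> matters only up to degree \<open>K - 1\<close>.\<close>
  have cut: "(G * H) $ n = (G * fps_cutoff K H) $ n" if "n < Suc K" for n
    unfolding fps_mult_nth
  proof (rule sum.cong[OF refl])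
    fix i assume "i \<in> {0..n}"
    then show "G $ i * H $ (n - i) = G $ i * fps_cutoff K H $ (n - i)"
      using that G0 by (cases "i = 0") auto
  qed
  have "(\<Sum>n<Suc K. (cmod ((F oo G) $ n))\<^sup>2 * s ^ (2 * n))
      = (cmod (F $ 0))\<^sup>2 + (\<Sum>n<K. (cmod ((G * H) $ Suc n))\<^sup>2 * s ^ (2 * Suc n))"
    by (subst sum.lessThan_Suc_shift) (simp add: comp)
  also have "(\<Sum>n<K. (cmod ((G * H) $ Suc n))\<^sup>2 * s ^ (2 * Suc n))
      \<le> (\<Sum>n<Suc K. (cmod ((G * H) $ n))\<^sup>2 * s ^ (2 * n))"
    unfolding sum.lessThan_Suc_shift[of _ K] by auto
  also have "\<dots> = (\<Sum>n<Suc K. (cmod ((G * fps_cutoff K H) $ n))\<^sup>2 * s ^ (2 * n))"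
    by (intro sum.cong refl) (simp add: cut)
  also have "\<dots> \<le> r\<^sup>2 * (\<Sum>n<K. (cmod (H $ n))\<^sup>2 * s ^ (2 * n))"
    by (rule fps_multiplier_bound[OF s G])
  also have "\<dots> \<le> r\<^sup>2 * (\<Sum>k<K. (cmod (F' $ k))\<^sup>2 * r ^ (2 * k))"
    unfolding H_def by (intro mult_left_mono Suc.IH) auto
  also have "\<dots> = (\<Sum>k<K. (cmod (F $ Suc k))\<^sup>2 * r ^ (2 * Suc k))"
    by (simp add: F'_def sum_distrib_left mult_ac power2_eq_square)
  also have "(cmod (F $ 0))\<^sup>2 + \<dots> = (\<Sum>k<Suc K. (cmod (F $ k))\<^sup>2 * r ^ (2 * k))"
    unfolding sum.lessThan_Suc_shift[of _ K] by simp
  finally show ?case by simp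
qed

section \<open>Weighted norms of coefficient sequences\<close>

definition hf_weighted :: "real \<Rightarrow> (int \<Rightarrow> complex) \<Rightarrow> int \<Rightarrow> real" where
  "hf_weighted s f k = cmod (f k) * s ^ nat \<bar>k\<bar>"

lemma hf_weighted_square: "(hf_weighted s f k)\<^sup>2 = (cmod (f k))\<^sup>2 * s ^ (2 * nat \<bar>k\<bar>)"
  by (simp add: hf_weighted_def power_mult_distrib power_mult[symmetric] mult.commute[of _ 2])

lemma hf_norm_nonneg: "hf_norm s f \<ge> 0"
  unfolding hf_norm_def by (intro real_sqrt_ge_zero infsum_nonneg) (simp add: power_mult)

lemma L2_set_le_hf_norm:
  assumes "f \<in> hyperfunctions s" "finite A"
  shows "L2_set (hf_weighted s f) A \<le> hf_norm s f"
proof -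
  have "(\<Sum>k\<in>A. (hf_weighted s f k)\<^sup>2) \<le> (\<Sum>\<^sub>\<infinity>k. (hf_weighted s f k)\<^sup>2)"
    using assms unfolding hyperfunctions_def hf_weighted_square[symmetric]
    by (intro finite_sum_le_infsum) auto
  then show ?thesis unfolding L2_set_def hf_norm_def hf_weighted_square[symmetric] by simp
qed

text \<open>Together with the preceding lemma this reduces every norm estimate, and every membership in the
space, to finite sums over symmetric intervals.\<close>

lemma hf_norm_bound:
  assumes "\<And>K::nat. L2_set (hf_weighted s f) {- int K..int K} \<le> B"
  shows "f \<in> hyperfunctions s" "hf_norm s f \<le> B"
proof -
  have B: "B \<ge> 0" using assms[of 0] L2_set_nonneg order_trans by blast
  have fin: "(\<Sum>k\<in>A. (hf_weighted s f k)\<^sup>2) \<le> B\<^sup>2" if finA: "finite A" for A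
  proof -
    obtain K :: nat where K: "A \<subseteq> {- int K..int K}"
    proof
      show "A \<subseteq> {- int (nat (\<Sum>k\<in>A. \<bar>k\<bar>))..int (nat (\<Sum>k\<in>A. \<bar>k\<bar>))}"
      proof
        fix k assume "k \<in> A"
        then have "\<bar>k\<bar> \<le> (\<Sum>k\<in>A. \<bar>k\<bar>)" using finA by (intro member_le_sum) auto
        then show "k \<in> {- int (nat (\<Sum>k\<in>A. \<bar>k\<bar>))..int (nat (\<Sum>k\<in>A. \<bar>k\<bar>))}" by auto
      qed
    qed
    have "(\<Sum>k\<in>A. (hf_weighted s f k)\<^sup>2) \<le> (\<Sum>k\<in>{- int K..int K}. (hf_weighted s f k)\<^sup>2)"
      using K by (intro sum_mono2) auto
    also have "\<dots> = (L2_set (hf_weighted s f) {- int K..int K})\<^sup>2"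
      by (simp add: L2_set_def sum_nonneg)
    also have "\<dots> \<le> B\<^sup>2" using assms by (intro power_mono) auto
    finally show ?thesis .
  qed
  have s: "(\<lambda>k. (hf_weighted s f k)\<^sup>2) summable_on UNIV"
    using fin by (intro nonneg_bdd_above_summable_on) (auto intro!: bdd_aboveI)
  then show "f \<in> hyperfunctions s" by (simp add: hyperfunctions_def hf_weighted_square)
  have "(\<Sum>\<^sub>\<infinity>k. (hf_weighted s f k)\<^sup>2) \<le> B\<^sup>2"
    using fin s by (intro infsum_le_finite_sums) auto
  then show "hf_norm s f \<le> B"
    using B unfolding hf_norm_def hf_weighted_square by (simp add: real_le_lsqrt)
qed

lemma hf_norm_le_scaled:
  assumes "g \<in> hyperfunctions r" "0 \<le> c" "0 \<le> s" "\<And>k. hf_weighted s f k \<le> c * hf_weighted r g k"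
  shows "f \<in> hyperfunctions s" "hf_norm s f \<le> c * hf_norm r g"
proof -
  have "L2_set (hf_weighted s f) A \<le> c * hf_norm r g" if "finite A" for A
  proof -
    have "L2_set (hf_weighted s f) A \<le> L2_set (\<lambda>k. c * hf_weighted r g k) A"
      using assms by (intro L2_set_mono) (auto simp: hf_weighted_def)
    also have "\<dots> = c * L2_set (hf_weighted r g) A"
      using assms by (simp add: L2_set_right_distrib)
    also have "\<dots> \<le> c * hf_norm r g"
      using assms that by (intro mult_left_mono L2_set_le_hf_norm) auto
    finally show ?thesis .
  qed
  then show "f \<in> hyperfunctions s" "hf_norm s f \<le> c * hf_norm r g"
    using hf_norm_bound[of s f "c * hf_norm r g"] by auto
qed

lemma hf_norm_scale:
  assumes "f \<in> hyperfunctions s" "0 \<le> s"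
  shows "(\<lambda>k. c * f k) \<in> hyperfunctions s" "hf_norm s (\<lambda>k. c * f k) \<le> cmod c * hf_norm s f"
  using hf_norm_le_scaled[of f s "cmod c" s "\<lambda>k. c * f k"] assms
  by (auto simp: hf_weighted_def norm_mult)

lemma hf_norm_add:
  assumes "f \<in> hyperfunctions s" "g \<in> hyperfunctions s" "0 \<le> s"
  shows "(\<lambda>k. f k + g k) \<in> hyperfunctions s"
        "hf_norm s (\<lambda>k. f k + g k) \<le> hf_norm s f + hf_norm s g"
proof -
  have "L2_set (hf_weighted s (\<lambda>k. f k + g k)) A \<le> hf_norm s f + hf_norm s g" if "finite A" for A
  proof -
    have "L2_set (hf_weighted s (\<lambda>k. f k + g k)) A
        \<le> L2_set (\<lambda>k. hf_weighted s f k + hf_weighted s g k) A"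
      using assms(3) unfolding hf_weighted_def
      by (intro L2_set_mono) (auto simp: norm_triangle_ineq mult_right_mono distrib_right[symmetric])
    also have "\<dots> \<le> L2_set (hf_weighted s f) A + L2_set (hf_weighted s g) A"
      by (rule L2_set_triangle_ineq)
    also have "\<dots> \<le> hf_norm s f + hf_norm s g"
      using assms that by (intro add_mono L2_set_le_hf_norm) auto
    finally show ?thesis .
  qed
  then show "(\<lambda>k. f k + g k) \<in> hyperfunctions s"
      "hf_norm s (\<lambda>k. f k + g k) \<le> hf_norm s f + hf_norm s g"
    using hf_norm_bound[of s "\<lambda>k. f k + g k"] by auto
qed

lemma hf_norm_mono:
  assumes "f \<in> hyperfunctions s" "0 \<le> r" "r \<le> s"
  shows "f \<in> hyperfunctions r" "hf_norm r f \<le> hf_norm s f"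
  using hf_norm_le_scaled[of f s 1 r f] assms
  by (auto simp: hf_weighted_def mult_left_mono power_mono)

lemma hyperfunctions0_mono:
  assumes "f \<in> hyperfunctions0 s" "0 \<le> r" "r \<le> s"
  shows "f \<in> hyperfunctions0 r"
  using assms hf_norm_mono(1) by (auto simp: hyperfunctions0_def)

text \<open>The absence of the constant coefficient is decisive here: each remaining frequency gains at least
one factor \<open>r / s\<close>.\<close>

lemma hf_norm_shrink:
  assumes f: "f \<in> hyperfunctions0 s" and r: "0 \<le> r" "r \<le> s" and s: "0 < s"
  shows "hf_norm r f \<le> r / s * hf_norm s f"
proof (rule hf_norm_le_scaled(2))
  show "f \<in> hyperfunctions s" using f by (simp add: hyperfunctions0_def)
  show "hf_weighted r f k \<le> r / s * hf_weighted s f k" for k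
  proof (cases "k = 0")
    case True
    then show ?thesis using f by (simp add: hf_weighted_def hyperfunctions0_def)
  next
    case False
    then obtain n where n: "nat \<bar>k\<bar> = Suc n" using gr0_implies_Suc[of "nat \<bar>k\<bar>"] by auto
    have "r ^ Suc n \<le> r * s ^ n" using r by (simp add: mult_left_mono power_mono)
    also have "\<dots> = r / s * s ^ Suc n" using s by simp
    finally have "cmod (f k) * r ^ Suc n \<le> cmod (f k) * (r / s * s ^ Suc n)"
      by (intro mult_left_mono) auto
    then show ?thesis unfolding hf_weighted_def n using s by (simp add: mult_ac)
  qed
qed (use r s in auto)

section \<open>Composition on coefficient sequences\<close>

text \<open>The coefficient sequence is split into its analytic and its antianalytic part. The latter is
conjugated, so that it too becomes a power series in \<open>z\<close>; both parts contain the constant term.\<close>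

definition fps_pos :: "(int \<Rightarrow> complex) \<Rightarrow> complex fps" where
  "fps_pos f = Abs_fps (\<lambda>n. f (int n))"

definition fps_neg :: "(int \<Rightarrow> complex) \<Rightarrow> complex fps" where
  "fps_neg f = Abs_fps (\<lambda>n. cnj (f (- int n)))"

text \<open>A map \<open>\<phi>\<close> of the unit circle into itself satisfies \<open>inverse (\<phi> ^ k) = cnj (\<phi> ^ k)\<close> there, so
composition with \<open>\<phi>\<close> acts on the conjugated antianalytic part as on the analytic one. When \<open>G\<close>
has no constant term, the composition of power series is exact: each of its coefficients involves
only finitely many coefficients of \<open>f\<close>, so linearity and triangularity hold without any limits.\<close>

definition comp_op :: "complex fps \<Rightarrow> hf_op" where
  "comp_op G f k = (if k \<ge> 0 then (fps_pos f oo G) $ nat k else cnj ((fps_neg f oo G) $ nat (- k)))"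

lemma comp_op_pos: "comp_op G f (int n) = (fps_pos f oo G) $ n"
  by (simp add: comp_op_def)

lemma comp_op_neg: "comp_op G f (- int n) = cnj ((fps_neg f oo G) $ n)"
  by (cases "n = 0") (auto simp: comp_op_def fps_pos_def fps_neg_def)

lemma comp_op_add: "comp_op G (\<lambda>k. f k + g k) = (\<lambda>k. comp_op G f k + comp_op G g k)"
proof -
  have "fps_pos (\<lambda>k. f k + g k) = fps_pos f + fps_pos g" "fps_neg (\<lambda>k. f k + g k) = fps_neg f + fps_neg g"
    by (auto simp: fps_pos_def fps_neg_def fps_eq_iff)
  then show ?thesis by (auto simp: comp_op_def fps_compose_add_distrib)
qed

lemma comp_op_scale: "comp_op G (\<lambda>k. c * f k) = (\<lambda>k. c * comp_op G f k)"
proof -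
  have "fps_pos (\<lambda>k. c * f k) = fps_const c * fps_pos f"
       "fps_neg (\<lambda>k. c * f k) = fps_const (cnj c) * fps_neg f"
    by (auto simp: fps_pos_def fps_neg_def fps_eq_iff)
  then show ?thesis
    by (auto simp: comp_op_def fps_compose_nth sum_distrib_left mult_ac intro!: ext)
qed

lemma comp_op_0: "comp_op G f 0 = f 0"
  by (simp add: comp_op_def fps_pos_def)

lemma sum_symmetric_int_interval:
  fixes a :: "int \<Rightarrow> real"
  shows "(\<Sum>k\<in>{- int K..int K}. a k) = (\<Sum>n<Suc K. a (int n)) + (\<Sum>n<Suc K. a (- int n)) - a 0"
proof (induction K)
  case 0
  then show ?case by simp
next
  case (Suc K)
  have "{- int (Suc K)..int (Suc K)} = insert (- int (Suc K)) (insert (int (Suc K)) {- int K..int K})"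
    by auto
  then show ?case using Suc by simp
qed

text \<open>Subordination applies to both halves: if the circle of radius \<open>s\<close> is sent into the disc of radius
\<open>r\<close>, then composition is a contraction from the space at radius \<open>r\<close> to the space at radius \<open>s\<close>.\<close>

lemma comp_op_bound:
  assumes s: "0 < s" "ereal s < fps_conv_radius G" and G0: "G $ 0 = 0"
    and G: "\<And>z. cmod z = s \<Longrightarrow> cmod (eval_fps G z) \<le> r"
    and f: "f \<in> hyperfunctions r"
  shows "comp_op G f \<in> hyperfunctions s" "hf_norm s (comp_op G f) \<le> hf_norm r f"
proof -
  have "L2_set (hf_weighted s (comp_op G f)) {- int K..int K} \<le> hf_norm r f" for K :: nat
  proof -
    note L = Littlewood_subordination[OF s G0 G, where K = "Suc K"]
    have "(\<Sum>k\<in>{- int K..int K}. (hf_weighted s (comp_op G f) k)\<^sup>2)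
        = (\<Sum>n<Suc K. (cmod ((fps_pos f oo G) $ n))\<^sup>2 * s ^ (2 * n))
          + (\<Sum>n<Suc K. (cmod ((fps_neg f oo G) $ n))\<^sup>2 * s ^ (2 * n)) - (cmod (f 0))\<^sup>2"
      unfolding sum_symmetric_int_interval hf_weighted_square comp_op_pos comp_op_neg
      by (simp add: comp_op_0)
    \<comment> \<open>The constant coefficient is counted twice on either side, with the same value, and drops out.\<close>
    also have "\<dots> \<le> (\<Sum>n<Suc K. (cmod (fps_pos f $ n))\<^sup>2 * r ^ (2 * n))
          + (\<Sum>n<Suc K. (cmod (fps_neg f $ n))\<^sup>2 * r ^ (2 * n)) - (cmod (f 0))\<^sup>2"
      by (intro diff_mono add_mono L) auto
    also have "\<dots> = (\<Sum>k\<in>{- int K..int K}. (hf_weighted r f k)\<^sup>2)"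
      unfolding sum_symmetric_int_interval hf_weighted_square
      by (simp add: fps_pos_def fps_neg_def)
    finally have "L2_set (hf_weighted s (comp_op G f)) {- int K..int K}
        \<le> L2_set (hf_weighted r f) {- int K..int K}"
      by (simp add: L2_set_def)
    also have "\<dots> \<le> hf_norm r f" using f by (rule L2_set_le_hf_norm) simp
    finally show ?thesis .
  qed
  then show "comp_op G f \<in> hyperfunctions s" "hf_norm s (comp_op G f) \<le> hf_norm r f"
    using hf_norm_bound[of s "comp_op G f"] by auto
qed

section \<open>Self-maps of the disc and their Koopman operators\<close>

text \<open>The properties of normalised finite Blaschke products that matter, in a form that is visibly
stable under composition. Unimodularity on the circle is needed for the negative powers of \<open>\<phi>\<close>.\<close>

definition disc_map :: "(complex \<Rightarrow> complex) \<Rightarrow> bool" where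
  "disc_map \<phi> \<longleftrightarrow> continuous_on (cball 0 1) \<phi> \<and> \<phi> holomorphic_on ball 0 1 \<and> \<phi> 0 = 0 \<and>
     (\<forall>z. cmod z < 1 \<longrightarrow> cmod (\<phi> z) < 1) \<and> (\<forall>z. cmod z = 1 \<longrightarrow> cmod (\<phi> z) = 1)"

lemma disc_map_cball: "disc_map \<phi> \<Longrightarrow> cmod z \<le> 1 \<Longrightarrow> cmod (\<phi> z) \<le> 1"
  unfolding disc_map_def by (metis order_le_less order_refl)

lemma disc_map_comp:
  assumes \<phi>: "disc_map \<phi>" and \<psi>: "disc_map \<psi>"
  shows "disc_map (\<phi> \<circ> \<psi>)"
  unfolding disc_map_def
proof (intro conjI allI impI)
  show "continuous_on (cball 0 1) (\<phi> \<circ> \<psi>)"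
  proof (rule continuous_on_compose)
    show "continuous_on (cball 0 1) \<psi>" using \<psi> by (simp add: disc_map_def)
    show "continuous_on (\<psi> ` cball 0 1) \<phi>"
      by (rule continuous_on_subset[of "cball 0 1"])
        (use \<phi> disc_map_cball[OF \<psi>] in \<open>auto simp: disc_map_def\<close>)
  qed
  show "\<phi> \<circ> \<psi> holomorphic_on ball 0 1"
    by (rule holomorphic_on_compose_gen[of \<psi> _ \<phi> "ball 0 1"])
      (use \<phi> \<psi> in \<open>simp_all add: disc_map_def image_subset_iff\<close>)
qed (use \<phi> \<psi> in \<open>simp_all add: disc_map_def\<close>)

lemma disc_map_id: "disc_map id"
  by (auto simp: disc_map_def id_def)

text \<open>Everything follows from
\<open>\<bar>1 - cnj l z\<bar>\<^sup>2 - \<bar>z - l\<bar>\<^sup>2 = (1 - \<bar>z\<bar>\<^sup>2) (1 - \<bar>l\<bar>\<^sup>2)\<close>.\<close>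

lemma blaschke_factor_norm:
  assumes "cmod l < 1" "cmod z \<le> 1"
  shows "1 - cnj l * z \<noteq> 0"
    and "cmod z < 1 \<Longrightarrow> cmod ((z - l) / (1 - cnj l * z)) < 1"
    and "cmod z = 1 \<Longrightarrow> cmod ((z - l) / (1 - cnj l * z)) = 1"
proof -
  have "cmod (cnj l * z) < 1"
    using assms by (simp add: norm_mult mult_le_one) (smt (verit) mult_left_le norm_ge_zero)
  then show nz: "1 - cnj l * z \<noteq> 0" by force
  have id: "(cmod (1 - cnj l * z))\<^sup>2 - (cmod (z - l))\<^sup>2 = (1 - (cmod z)\<^sup>2) * (1 - (cmod l)\<^sup>2)"
    unfolding cmod_power2 by (simp add: power2_eq_square algebra_simps)
  have l: "(cmod l)\<^sup>2 < 1" using assms by (simp add: abs_square_less_1)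
  show "cmod ((z - l) / (1 - cnj l * z)) < 1" if "cmod z < 1"
  proof -
    have "(cmod z)\<^sup>2 < 1" using that by (simp add: abs_square_less_1)
    then have "(cmod (z - l))\<^sup>2 < (cmod (1 - cnj l * z))\<^sup>2"
      using id l by (smt (verit) mult_pos_pos)
    then have "cmod (z - l) < cmod (1 - cnj l * z)"
      by (rule power2_less_imp_less) simp
    then show ?thesis using nz by (simp add: norm_divide)
  qed
  show "cmod ((z - l) / (1 - cnj l * z)) = 1" if "cmod z = 1"
  proof -
    have "cmod (z - l) = cmod (1 - cnj l * z)"
      using id that by (simp add: power2_eq_iff_nonneg)
    then show ?thesis using nz by (simp add: norm_divide)
  qed
qed

lemma disc_map_blaschke:
  assumes "finite_blaschke \<phi>" "\<phi> 0 = 0"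
  shows "disc_map \<phi>"
proof -
  obtain \<psi> :: real and q :: nat and l where q: "1 \<le> q" and l': "\<forall>i\<in>{1..q}. cmod (l i) < 1"
    and \<phi>': "\<forall>z\<in>cball 0 1. \<phi> z = cis \<psi> * (\<Prod>i\<in>{1..q}. (z - l i) / (1 - cnj (l i) * z))"
    using assms(1) unfolding finite_blaschke_def by (elim exE conjE)
  note l = l'[rule_format] and \<phi> = \<phi>'[rule_format, unfolded mem_cball_0]
  let ?B = "\<lambda>z. cis \<psi> * (\<Prod>i\<in>{1..q}. (z - l i) / (1 - cnj (l i) * z))"
  have "continuous_on (cball 0 1) ?B"
    using blaschke_factor_norm(1)[OF l] by (intro continuous_intros) (auto simp: dist_norm)
  then have "continuous_on (cball 0 1) \<phi>"
    by (rule continuous_on_eq) (auto simp: \<phi>)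
  moreover have "?B holomorphic_on ball 0 1"
    using blaschke_factor_norm(1)[OF l] by (intro holomorphic_intros) (auto simp: dist_norm)
  then have "\<phi> holomorphic_on ball 0 1"
    by (rule holomorphic_transform) (auto simp: \<phi>)
  moreover have "cmod (\<phi> z) < 1" if z: "cmod z < 1" for z
  proof -
    have "cmod (\<phi> z) = (\<Prod>i\<in>{1..q}. cmod ((z - l i) / (1 - cnj (l i) * z)))"
      using z by (simp add: \<phi> norm_mult prod_norm)
    \<comment> \<open>The product is not empty; a single factor already makes the bound strict.\<close>
    also have "\<dots> = cmod ((z - l 1) / (1 - cnj (l 1) * z)) *
        (\<Prod>i\<in>{1..q} - {1}. cmod ((z - l i) / (1 - cnj (l i) * z)))"
      using q by (intro prod.remove) auto
    also have "\<dots> \<le> cmod ((z - l 1) / (1 - cnj (l 1) * z)) * 1"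
      using blaschke_factor_norm(2)[OF l less_imp_le[OF z] z]
      by (intro mult_left_mono prod_le_1) (auto simp: less_imp_le)
    also have "\<dots> < 1" using blaschke_factor_norm(2)[OF l _ z, of 1] z q by simp
    finally show ?thesis .
  qed
  moreover have "cmod (\<phi> z) = 1" if z: "cmod z = 1" for z
    using z blaschke_factor_norm(3)[OF l _ z]
    by (simp add: \<phi> norm_mult prod_norm[symmetric])
  ultimately show ?thesis using assms(2) by (simp add: disc_map_def)
qed

lemma disc_map_fps:
  assumes "disc_map \<phi>"
  shows "fps_conv_radius (fps_expansion \<phi> 0) \<ge> 1"
    and "\<And>z. cmod z < 1 \<Longrightarrow> eval_fps (fps_expansion \<phi> 0) z = \<phi> z"
    and "fps_expansion \<phi> 0 $ 0 = 0"
    and "fps_expansion \<phi> 0 $ 1 = deriv \<phi> 0"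
proof -
  have h: "\<phi> holomorphic_on eball 0 (ereal 1)" using assms by (simp add: disc_map_def)
  show "fps_conv_radius (fps_expansion \<phi> 0) \<ge> 1"
    using conv_radius_fps_expansion[OF h] by (simp add: one_ereal_def)
  show "eval_fps (fps_expansion \<phi> 0) z = \<phi> z" if "cmod z < 1" for z
    using eval_fps_expansion'[OF h, of z] that by simp
  show "fps_expansion \<phi> 0 $ 0 = 0" "fps_expansion \<phi> 0 $ 1 = deriv \<phi> 0"
    using assms by (simp_all add: fps_expansion_def disc_map_def)
qed

text \<open>Cauchy's formulas at the centre hold on the unit circle itself, as they need only continuity up
to the boundary. A negative index is the case of the constant term of \<open>g z * z ^ n\<close>, which is zero.\<close>

lemma fourier_coeff_disc_algebra:
  assumes cont: "continuous_on (cball 0 1) g" and hol: "g holomorphic_on ball 0 1"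
  shows "fourier_coeff g (int n) = fps_expansion g 0 $ n"
    and "n > 0 \<Longrightarrow> fourier_coeff g (- int n) = 0"
proof -
  have *: "fourier_coeff g (int n) = fps_expansion g 0 $ n"
    if cont: "continuous_on (cball 0 1) g" and hol: "g holomorphic_on ball 0 1" for g n
  proof -
    let ?I = "(2 * pi * \<i>) / fact n * (deriv ^^ n) g 0"
    have "((\<lambda>u. g u / (u - 0) ^ Suc n) has_contour_integral ?I) (circlepath 0 1)"
      by (rule Cauchy_has_contour_integral_higher_derivative_circlepath[OF cont hol]) simp
    then have "((\<lambda>t. g (cis t) / cis t ^ Suc n * \<i> * cis t) has_integral ?I) {0..2 * pi}"
      unfolding circlepath_def
      by (subst (asm) has_contour_integral_part_circlepath_iff) auto
    also have "(\<lambda>t. g (cis t) / cis t ^ Suc n * \<i> * cis t) = (\<lambda>t. \<i> * (g (cis t) * cis (- (of_int (int n) * t))))"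
      by (auto simp: Complex.DeMoivre divide_inverse simp flip: cis_inverse cis_mult)
    finally have "((\<lambda>t. - \<i> * (\<i> * (g (cis t) * cis (- (of_int (int n) * t))))) has_integral (- \<i> * ?I)) {0..2 * pi}"
      by (rule has_integral_mult_right)
    then have "((\<lambda>t. g (cis t) * cis (- (of_int (int n) * t))) has_integral (- \<i> * ?I)) {0..2 * pi}"
      by (simp add: mult.assoc[symmetric])
    from integral_unique[OF this] show ?thesis
      by (simp add: fourier_coeff_def fps_expansion_def)
  qed
  show "fourier_coeff g (int n) = fps_expansion g 0 $ n" by (rule *[OF cont hol])
  show "fourier_coeff g (- int n) = 0" if "n > 0"
  proof -
    have "fourier_coeff g (- int n) = fourier_coeff (\<lambda>z. g z * z ^ n) (int 0)"
      by (simp add: fourier_coeff_def Complex.DeMoivre mult.commute)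
    also have "\<dots> = fps_expansion (\<lambda>z. g z * z ^ n) 0 $ 0"
      using cont hol by (intro * continuous_intros holomorphic_intros) auto
    also have "\<dots> = 0" using that by (simp add: fps_expansion_def)
    finally show ?thesis .
  qed
qed

lemma fourier_coeff_cnj: "fourier_coeff (\<lambda>z. cnj (g z)) k = cnj (fourier_coeff g (- k))"
  unfolding fourier_coeff_def
  by (simp add: integral_cnj cis_cnj)

lemma fourier_coeff_cong:
  "(\<And>z. cmod z = 1 \<Longrightarrow> f z = g z) \<Longrightarrow> fourier_coeff f k = fourier_coeff g k"
  unfolding fourier_coeff_def by (intro arg_cong2[where f = "(/)"] integral_cong) auto

lemma fourier_coeff_power:
  assumes \<phi>: "disc_map \<phi>"
  defines "G \<equiv> fps_expansion \<phi> 0"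
  shows "fourier_coeff (\<lambda>z. \<phi> z ^ m) (int n) = (G ^ m) $ n"
    and "n > 0 \<Longrightarrow> fourier_coeff (\<lambda>z. \<phi> z ^ m) (- int n) = 0"
proof -
  have c: "continuous_on (cball 0 1) (\<lambda>z. \<phi> z ^ m)" and h: "(\<lambda>z. \<phi> z ^ m) holomorphic_on ball 0 1"
    using \<phi> by (auto simp: disc_map_def intro!: continuous_intros holomorphic_intros)
  have "\<phi> has_fps_expansion G"
    unfolding G_def using \<phi> by (intro has_fps_expansion_fps_expansion[of "ball 0 1"]) (auto simp: disc_map_def)
  then have "(\<lambda>z. \<phi> z ^ m) has_fps_expansion G ^ m"
    by (rule has_fps_expansion_power)
  then have "fps_expansion (\<lambda>z. \<phi> z ^ m) 0 = G ^ m" by (rule fps_expansion_eqI)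
  then show "fourier_coeff (\<lambda>z. \<phi> z ^ m) (int n) = (G ^ m) $ n"
    using fourier_coeff_disc_algebra(1)[OF c h] by simp
  show "n > 0 \<Longrightarrow> fourier_coeff (\<lambda>z. \<phi> z ^ m) (- int n) = 0"
    using fourier_coeff_disc_algebra(2)[OF c h] by simp
qed

text \<open>On the circle a negative power of \<open>\<phi>\<close> is the conjugate of a positive one, which reflects its
Fourier coefficients.\<close>

lemma fourier_coeff_powi:
  assumes \<phi>: "disc_map \<phi>"
  defines "G \<equiv> fps_expansion \<phi> 0"
  shows "fourier_coeff (\<lambda>z. \<phi> z powi k) (int n) = (if k \<ge> 0 then (G ^ nat k) $ n else 0)"
    and "fourier_coeff (\<lambda>z. \<phi> z powi k) (- int n) = (if k \<le> 0 then cnj ((G ^ nat (- k)) $ n) else 0)"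
proof -
  have G0: "G $ 0 = 0" unfolding G_def using \<phi> by (rule disc_map_fps)
  have neg: "fourier_coeff (\<lambda>z. \<phi> z powi k) i = cnj (fourier_coeff (\<lambda>z. \<phi> z ^ nat (- k)) (- i))"
    if "k \<le> 0" for i
  proof -
    have "\<phi> z powi k = cnj (\<phi> z ^ nat (- k))" if z: "cmod z = 1" for z
    proof -
      have "cmod (\<phi> z ^ nat (- k)) = 1" using \<phi> z by (simp add: disc_map_def norm_power)
      then have "inverse (\<phi> z ^ nat (- k)) = cnj (\<phi> z ^ nat (- k))"
        by (metis complex_div_cnj div_by_1 divide_inverse mult_1 of_real_1 power_one)
      then show ?thesis using \<open>k \<le> 0\<close> by (auto simp: power_int_def power_inverse)
    qed
    then show ?thesis by (subst fourier_coeff_cnj[symmetric]) (rule fourier_coeff_cong)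
  qed
  have pos: "(\<lambda>z. \<phi> z powi k) = (\<lambda>z. \<phi> z ^ nat k)" if "k \<ge> 0"
    using that by (simp add: power_int_def)
  show "fourier_coeff (\<lambda>z. \<phi> z powi k) (int n) = (if k \<ge> 0 then (G ^ nat k) $ n else 0)"
  proof (cases "k \<ge> 0")
    case True
    then show ?thesis using fourier_coeff_power(1)[OF \<phi>] by (simp add: pos G_def)
  next
    case False
    then show ?thesis
      using neg[of "int n"] fourier_coeff_power(2)[OF \<phi>, of n] fourier_coeff_power(1)[OF \<phi>, of "nat (- k)" 0] G0
      by (cases "n = 0") (auto simp: G_def)
  qed
  show "fourier_coeff (\<lambda>z. \<phi> z powi k) (- int n) = (if k \<le> 0 then cnj ((G ^ nat (- k)) $ n) else 0)"
  proof (cases "k \<le> 0")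
    case True
    then show ?thesis using fourier_coeff_power(1)[OF \<phi>] by (simp add: neg G_def)
  next
    case False
    then show ?thesis
      using fourier_coeff_power(2)[OF \<phi>, of n] fourier_coeff_power(1)[OF \<phi>, of "nat k" 0] G0
      by (cases "n = 0") (auto simp: G_def pos)
  qed
qed

lemma fourier_coeff_sum:
  assumes "finite A" and c: "\<And>i. i \<in> A \<Longrightarrow> continuous_on (sphere 0 1) (g i)"
  shows "fourier_coeff (\<lambda>z. \<Sum>i\<in>A. p i * g i z) k = (\<Sum>i\<in>A. p i * fourier_coeff (g i) k)"
proof -
  have cis: "continuous_on S cis" for S by (intro continuous_intros)
  have "(\<lambda>t. g i (cis t) * cis (- (of_int k * t))) integrable_on {0..2 * pi}" if "i \<in> A" for i
  proof (rule integrable_continuous_interval)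
    show "continuous_on {0..2 * pi} (\<lambda>t. g i (cis t) * cis (- (of_int k * t)))"
      using c[OF that] by (intro continuous_intros continuous_on_compose2[OF c[OF that]]) auto
  qed
  then have "integral {0..2 * pi} (\<lambda>t. \<Sum>i\<in>A. p i * (g i (cis t) * cis (- (of_int k * t))))
      = (\<Sum>i\<in>A. p i * integral {0..2 * pi} (\<lambda>t. g i (cis t) * cis (- (of_int k * t))))"
    using assms(1) by (subst integral_sum) (auto intro: integrable_on_mult_right)
  then show ?thesis
    by (simp add: fourier_coeff_def sum_divide_distrib sum_distrib_right mult.assoc)
qed

text \<open>Since \<open>\<phi> ^ i\<close> vanishes at the origin to order at least \<open>i\<close>, the terms of \<open>p\<close> beyond degree \<open>n\<close> do
not reach the \<open>n\<close>-th coefficient.\<close>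

lemma comp_op_trig_poly:
  assumes \<phi>: "disc_map \<phi>" and p: "p \<in> trig_polys"
  shows "comp_op (fps_expansion \<phi> 0) p = fourier_coeff (\<lambda>z. trig_poly_eval p (\<phi> z))"
proof
  fix k
  define G where "G = fps_expansion \<phi> 0"
  define S where "S = {k. p k \<noteq> 0}"
  have S: "finite S" using p by (simp add: S_def trig_polys_def)
  have G0: "G $ 0 = 0" unfolding G_def using \<phi> by (rule disc_map_fps)
  have "fourier_coeff (\<lambda>z. trig_poly_eval p (\<phi> z)) k = (\<Sum>i\<in>S. p i * fourier_coeff (\<lambda>z. \<phi> z powi i) k)"
    unfolding trig_poly_eval_def S_def[symmetric] 
  proof (rule fourier_coeff_sum[OF S])
    fix i
    have "continuous_on (sphere 0 1) \<phi>"
      by (rule continuous_on_subset[of "cball 0 1"]) (use \<phi> in \<open>auto simp: disc_map_def\<close>)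
    moreover have "\<phi> z \<noteq> 0" if "cmod z = 1" for z
      using \<phi> that unfolding disc_map_def by (metis norm_zero zero_neq_one)
    ultimately show "continuous_on (sphere 0 1) (\<lambda>z. \<phi> z powi i)"
      by (intro continuous_intros) auto
  qed
  also have "\<dots> = comp_op G p k"
  proof (cases "k \<ge> 0")
    case True
    then obtain n where k: "k = int n" using nonneg_int_cases by blast
    have "(\<Sum>i\<in>S. p i * fourier_coeff (\<lambda>z. \<phi> z powi i) k) = (\<Sum>i\<in>S. p i * (if i \<ge> 0 then (G ^ nat i) $ n else 0))"
      by (simp add: k fourier_coeff_powi[OF \<phi>, folded G_def])
    also have "\<dots> = (\<Sum>i\<in>int ` {0..n}. p i * (if i \<ge> 0 then (G ^ nat i) $ n else 0))"
    proof (rule sum.mono_neutral_cong[OF _ S])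
      fix i assume i: "i \<in> S - int ` {0..n}"
      show "p i * (if i \<ge> 0 then (G ^ nat i) $ n else 0) = 0"
      proof (cases "i \<ge> 0")
        case True
        then have "n < nat i" using i by (metis DiffE atLeastAtMost_iff image_eqI int_nat_eq linorder_not_less zero_le)
        then show ?thesis using startsby_zero_power_prefix[OF G0] by auto
      qed simp
    qed (auto simp: S_def)
    also have "\<dots> = (\<Sum>i=0..n. p (int i) * (G ^ i) $ n)"
      by (subst sum.reindex) auto
    also have "\<dots> = comp_op G p k"
      unfolding k comp_op_pos by (simp add: fps_compose_nth fps_pos_def)
    finally show ?thesis .
  next
    case False
    then obtain n where k: "k = - int n" by (metis int_cases2 of_nat_0_le_iff)
    have "(\<Sum>i\<in>S. p i * fourier_coeff (\<lambda>z. \<phi> z powi i) k) = (\<Sum>i\<in>S. p i * (if i \<le> 0 then cnj ((G ^ nat (- i)) $ n) else 0))"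
      by (simp add: k fourier_coeff_powi[OF \<phi>, folded G_def])
    also have "\<dots> = (\<Sum>i\<in>(\<lambda>i. - int i) ` {0..n}. p i * (if i \<le> 0 then cnj ((G ^ nat (- i)) $ n) else 0))"
    proof (rule sum.mono_neutral_cong[OF _ S])
      fix i assume i: "i \<in> S - (\<lambda>i. - int i) ` {0..n}"
      show "p i * (if i \<le> 0 then cnj ((G ^ nat (- i)) $ n) else 0) = 0"
      proof (cases "i \<le> 0")
        case True
        have "n < nat (- i)"
        proof (rule ccontr)
          assume "\<not> n < nat (- i)"
          with True have "i = - int (nat (- i))" "nat (- i) \<in> {0..n}" by auto
          then show False using i by blast
        qed
        then show ?thesis using startsby_zero_power_prefix[OF G0] by auto
      qed simp
    qed (auto simp: S_def)
    also have "\<dots> = (\<Sum>i=0..n. p (- int i) * cnj ((G ^ i) $ n))"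
      by (subst sum.reindex) (auto simp: inj_on_def)
    also have "\<dots> = comp_op G p k"
      unfolding k comp_op_neg by (simp add: fps_compose_nth fps_neg_def)
    finally show ?thesis .
  qed
  finally show "comp_op (fps_expansion \<phi> 0) p k = fourier_coeff (\<lambda>z. trig_poly_eval p (\<phi> z)) k"
    by (simp add: G_def)
qed

lemma bounded_op_add:
  "bounded_op \<theta> V T \<Longrightarrow> f \<in> V \<Longrightarrow> g \<in> V \<Longrightarrow> T (\<lambda>k. f k + g k) = (\<lambda>k. T f k + T g k)"
  by (simp add: bounded_op_def)

lemma bounded_op_scale: "bounded_op \<theta> V T \<Longrightarrow> f \<in> V \<Longrightarrow> T (\<lambda>k. c * f k) = (\<lambda>k. c * T f k)"
  by (simp add: bounded_op_def)

lemma bounded_op_closed: "bounded_op \<theta> V T \<Longrightarrow> f \<in> V \<Longrightarrow> T f \<in> V"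
  by (simp add: bounded_op_def)

text \<open>Density of the trigonometric polynomials; this is the uniqueness half of identifying the Koopman
operator.\<close>

lemma bounded_op_eqI:
  assumes \<theta>: "0 < \<theta>" and S: "bounded_op \<theta> (hyperfunctions \<theta>) S" and T: "bounded_op \<theta> (hyperfunctions \<theta>) T"
    and eq: "\<And>p. p \<in> trig_polys \<Longrightarrow> S p = T p" and f: "f \<in> hyperfunctions \<theta>"
  shows "S f = T f"
proof
  fix k
  let ?V = "hyperfunctions \<theta>"
  obtain C D where C: "\<And>g. g \<in> ?V \<Longrightarrow> hf_norm \<theta> (S g) \<le> C * hf_norm \<theta> g"
    and D: "\<And>g. g \<in> ?V \<Longrightarrow> hf_norm \<theta> (T g) \<le> D * hf_norm \<theta> g"
    using S T unfolding bounded_op_def by meson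
  define B where "B = \<bar>C\<bar> + \<bar>D\<bar> + 1"
  have B: "B > 0" by (simp add: B_def)
  have "cmod (S f k - T f k) * \<theta> ^ nat \<bar>k\<bar> \<le> 0 + e" if e: "e > 0" for e
  proof -
    obtain p where p: "p \<in> trig_polys" "hf_norm \<theta> (\<lambda>k. f k - p k) < e / B"
      using trig_polys_dense[OF \<theta> f, of "e / B"] e B by auto
    let ?g = "\<lambda>k. f k - p k"
    have pV: "p \<in> ?V" using p trig_polys_subset by blast
    have g: "?g \<in> ?V" using hyperfunctions_diff[OF \<theta> f pV] .
    have sp: "R f = (\<lambda>k. R ?g k + R p k)" if "bounded_op \<theta> ?V R" for R
    proof -
      have "(\<lambda>k. ?g k + p k) = f" by simp
      then show ?thesis using bounded_op_add[OF that g pV] by simp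
    qed
    have "S f k - T f k = S ?g k - T ?g k"
      using sp[OF S] sp[OF T] eq[OF p(1)] by simp
    then have "cmod (S f k - T f k) * \<theta> ^ nat \<bar>k\<bar>
        \<le> (cmod (S ?g k) + cmod (T ?g k)) * \<theta> ^ nat \<bar>k\<bar>"
      using \<theta> by (simp add: norm_triangle_ineq4)
    also have "\<dots> = L2_set (hf_weighted \<theta> (S ?g)) {k} + L2_set (hf_weighted \<theta> (T ?g)) {k}"
      using \<theta> by (simp add: hf_weighted_def distrib_right)
    also have "\<dots> \<le> hf_norm \<theta> (S ?g) + hf_norm \<theta> (T ?g)"
      using S T g by (intro add_mono L2_set_le_hf_norm) (auto simp: bounded_op_def)
    also have "\<dots> \<le> C * hf_norm \<theta> ?g + D * hf_norm \<theta> ?g"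
      using C D g by (intro add_mono) auto
    also have "\<dots> \<le> B * hf_norm \<theta> ?g"
      unfolding distrib_right[symmetric] by (intro mult_right_mono hf_norm_nonneg) (auto simp: B_def)
    also have "\<dots> \<le> e" using p(2) B by (simp add: field_simps)
    finally show ?thesis by simp
  qed
  then have "cmod (S f k - T f k) * \<theta> ^ nat \<bar>k\<bar> \<le> 0" by (rule field_le_epsilon)
  moreover have "0 < \<theta> ^ nat \<bar>k\<bar>" using \<theta> by simp
  ultimately show "S f k = T f k" by (simp add: mult_le_0_iff)
qed

lemma comp_op_disc_map_bound:
  assumes \<phi>: "disc_map \<phi>" and s: "0 < s" "s < 1"
    and r: "\<And>z. cmod z = s \<Longrightarrow> cmod (\<phi> z) \<le> r" and f: "f \<in> hyperfunctions r"
  shows "comp_op (fps_expansion \<phi> 0) f \<in> hyperfunctions s"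
        "hf_norm s (comp_op (fps_expansion \<phi> 0) f) \<le> hf_norm r f"
proof -
  have "ereal s < 1" using s by (simp add: one_ereal_def)
  then have c: "ereal s < fps_conv_radius (fps_expansion \<phi> 0)"
    using disc_map_fps(1)[OF \<phi>] by (rule less_le_trans)
  show "comp_op (fps_expansion \<phi> 0) f \<in> hyperfunctions s"
        "hf_norm s (comp_op (fps_expansion \<phi> 0) f) \<le> hf_norm r f"
    by (rule comp_op_bound[OF s(1) c disc_map_fps(3)[OF \<phi>] _ f]; use s r disc_map_fps(2)[OF \<phi>] in simp)+
qed

lemma disc_map_Schwarz:
  assumes "disc_map \<phi>" "cmod z < 1"
  shows "cmod (\<phi> z) \<le> cmod z"
  using assms unfolding disc_map_def by (intro Schwarz_Lemma(1)) auto

text \<open>The coefficientwise composition operator is bounded because \<open>\<phi>\<close> maps the disc of radius \<open>\<theta>\<close> into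
itself, and it agrees with composition on trigonometric polynomials; by density it is the
continuous extension.\<close>

lemma koopman_eq:
  assumes \<phi>: "disc_map \<phi>" and \<theta>: "0 < \<theta>" "\<theta> < 1"
  shows "koopman \<theta> \<phi> = restrict (comp_op (fps_expansion \<phi> 0)) (hyperfunctions \<theta>)"
  unfolding koopman_def
proof (rule the_equality)
  let ?V = "hyperfunctions \<theta>" and ?T = "restrict (comp_op (fps_expansion \<phi> 0)) (hyperfunctions \<theta>)"
  have bd: "comp_op (fps_expansion \<phi> 0) f \<in> ?V \<and> hf_norm \<theta> (comp_op (fps_expansion \<phi> 0) f) \<le> 1 * hf_norm \<theta> f"
    if "f \<in> ?V" for f
    using comp_op_disc_map_bound[OF \<phi> \<theta> _ that] disc_map_Schwarz[OF \<phi>] \<theta> by auto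
  have "bounded_op \<theta> ?V ?T"
    unfolding bounded_op_def
  proof (intro conjI)
    show "\<exists>C. \<forall>f\<in>?V. hf_norm \<theta> (?T f) \<le> C * hf_norm \<theta> f"
      using bd by (intro exI[of _ 1]) auto
  qed (use bd \<theta> in \<open>auto simp: hf_norm_add hf_norm_scale comp_op_add comp_op_scale\<close>)
  then show *: "bounded_op \<theta> ?V ?T \<and> ?T \<in> extensional ?V \<and>
      (\<forall>p\<in>trig_polys. ?T p = fourier_coeff (\<lambda>z. trig_poly_eval p (\<phi> z)))"
    using comp_op_trig_poly[OF \<phi>] trig_polys_subset by auto
  fix T assume T: "bounded_op \<theta> ?V T \<and> T \<in> extensional ?V \<and>
      (\<forall>p\<in>trig_polys. T p = fourier_coeff (\<lambda>z. trig_poly_eval p (\<phi> z)))"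
  show "T = ?T"
  proof (rule extensionalityI)
    show "T \<in> extensional ?V" "?T \<in> extensional ?V" using T by simp_all
    fix f assume f: "f \<in> ?V"
    show "T f = ?T f"
    proof (rule bounded_op_eqI[OF \<theta>(1) _ _ _ f])
      show "bounded_op \<theta> ?V T" "bounded_op \<theta> ?V ?T" using T * by blast+
      show "T p = ?T p" if "p \<in> trig_polys" for p
        using T * that by (metis (no_types, lifting))
    qed
  qed
qed

section \<open>Contraction rates\<close>

text \<open>For \<open>\<phi> z = z h z\<close> the quotient \<open>h\<close> maps the disc strictly into itself: \<open>\<bar>h\<bar> = 1\<close> somewhere would make
\<open>\<phi>\<close> a rotation. Moving \<open>a = h 0\<close> to the origin by a Moebius map, the Schwarz lemma bounds the
pseudo-hyperbolic distance of \<open>h z\<close> and \<open>a\<close> by \<open>\<bar>z\<bar>\<close>, and this confines \<open>\<bar>h z\<bar>\<close>.\<close>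

lemma disc_map_Schwarz_Pick:
  assumes \<phi>: "disc_map \<phi>" and d: "cmod (deriv \<phi> 0) < 1" and z: "cmod z < 1"
  shows "cmod (\<phi> z) \<le> cmod z * ((cmod z + cmod (deriv \<phi> 0)) / (1 + cmod (deriv \<phi> 0) * cmod z))"
proof -
  have hol: "\<phi> holomorphic_on ball 0 1" and 0: "\<phi> 0 = 0"
    and lt: "\<And>z. cmod z < 1 \<Longrightarrow> cmod (\<phi> z) < 1"
    using \<phi> by (auto simp: disc_map_def)
  obtain h where h: "h holomorphic_on ball 0 1" "\<And>z. cmod z < 1 \<Longrightarrow> \<phi> z = z * h z" "deriv \<phi> 0 = h 0"
    using Schwarz3[OF hol 0] by blast
  have h1: "cmod (h w) < 1" if w: "cmod w < 1" for w
  proof (cases "w = 0")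
    case True
    then show ?thesis using d h(3) by simp
  next
    case False
    have "cmod (\<phi> w) \<noteq> cmod w"
    proof
      assume "cmod (\<phi> w) = cmod w"
      then obtain \<alpha> where \<alpha>: "\<And>z. cmod z < 1 \<Longrightarrow> \<phi> z = \<alpha> * z" "cmod \<alpha> = 1"
        using Schwarz_Lemma(3)[OF hol 0 lt w] w False by blast
      have "deriv \<phi> 0 = deriv (\<lambda>z. \<alpha> * z) 0"
        by (rule complex_derivative_transform_within_open[of _ "ball 0 1"])
          (use hol \<alpha> in \<open>auto intro!: holomorphic_intros\<close>)
      then show False using \<alpha>(2) d by simp
    qed
    then have "cmod (\<phi> w) < cmod w" using disc_map_Schwarz[OF \<phi> w] by simp
    then have "cmod w * cmod (h w) < cmod w * 1" using h(2)[OF w] by (simp add: norm_mult)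
    then show ?thesis using False by (metis mult_less_cancel_left_pos zero_less_norm_iff)
  qed
  define a w t where "a = h 0" and "w = h z" and "t = cmod z"
  have a: "cmod a < 1" and w: "cmod w < 1" and t: "0 \<le> t" "t < 1"
    using h1[of 0] h1[OF z] z by (auto simp: a_def w_def t_def)
  have "cmod ((h z - a) / (1 - cnj a * h z)) \<le> cmod z"
  proof (rule Schwarz_Lemma(1)[where f = "\<lambda>z. (h z - a) / (1 - cnj a * h z)", OF _ _ _ z])
    show "(\<lambda>z. (h z - a) / (1 - cnj a * h z)) holomorphic_on ball 0 1"
      using blaschke_factor_norm(1)[OF a] h1 by (intro holomorphic_intros h(1)) (auto simp: less_imp_le)
  qed (use blaschke_factor_norm(2)[OF a] h1 in \<open>auto simp: a_def less_imp_le\<close>)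
  then have "cmod (w - a) \<le> t * cmod (1 - cnj a * w)"
    using blaschke_factor_norm(1)[OF a, of w] w by (simp add: w_def t_def norm_divide divide_le_eq)
  then have sq: "(cmod (w - a))\<^sup>2 \<le> t\<^sup>2 * (cmod (1 - cnj a * w))\<^sup>2"
    using power_mono[of _ "t * cmod (1 - cnj a * w)" 2] by (simp add: power_mult_distrib)
  have id: "(cmod (1 - cnj a * w))\<^sup>2 = (cmod (w - a))\<^sup>2 + (1 - (cmod w)\<^sup>2) * (1 - (cmod a)\<^sup>2)"
    unfolding cmod_power2 by (simp add: power2_eq_square algebra_simps)
  define W L where "W = cmod w" and "L = cmod a"
  have "\<bar>W - L\<bar> \<le> cmod (w - a)"
    unfolding W_def L_def by (rule norm_triangle_ineq3)
  then have "(W - L)\<^sup>2 \<le> (cmod (w - a))\<^sup>2"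
    by (metis abs_ge_zero power2_abs power_mono)
  moreover have "0 \<le> 1 - t\<^sup>2" using t by (simp add: power_le_one)
  ultimately have "(1 - t\<^sup>2) * (W - L)\<^sup>2 \<le> (1 - t\<^sup>2) * (cmod (w - a))\<^sup>2"
    by (intro mult_left_mono)
  also have "\<dots> \<le> t\<^sup>2 * ((1 - W\<^sup>2) * (1 - L\<^sup>2))"
    using sq unfolding id by (simp add: W_def L_def algebra_simps)
  \<comment> \<open>This is a comparison of squares because \<open>(1 - W L)\<^sup>2 - (W - L)\<^sup>2 = (1 - W\<^sup>2) (1 - L\<^sup>2)\<close>.\<close>
  finally have "(W - L)\<^sup>2 \<le> (t * (1 - W * L))\<^sup>2"
    by (simp add: power2_eq_square algebra_simps)
  moreover have "0 \<le> t * (1 - W * L)"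
    using t w a by (simp add: W_def L_def mult_le_one less_imp_le)
  ultimately have "W - L \<le> t * (1 - W * L)" by (rule power2_le_imp_le)
  then have "W \<le> (t + L) / (1 + L * t)"
    using t by (subst pos_le_divide_eq) (auto simp: L_def add_pos_nonneg algebra_simps)
  then have "t * W \<le> t * ((t + L) / (1 + L * t))" using t by (intro mult_left_mono)
  then show ?thesis using h(2)[OF z] by (simp add: t_def W_def L_def w_def a_def h(3) norm_mult)
qed

text \<open>The factor in the Schwarz--Pick bound for maps whose derivative at the origin has modulus at most \<open>L\<close>.\<close>

definition contraction_ratio :: "real \<Rightarrow> real \<Rightarrow> real" where
  "contraction_ratio L s = (s + L) / (1 + L * s)"

text \<open>Any composition of \<open>n\<close> such maps sends the disc of radius \<open>s\<close> into the disc of this radius.\<close>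

primrec contraction_radius :: "real \<Rightarrow> real \<Rightarrow> nat \<Rightarrow> real" where
  "contraction_radius L s 0 = s"
| "contraction_radius L s (Suc n)
     = contraction_radius L s n * contraction_ratio L (contraction_radius L s n)"

lemma contraction_ratio_mono:
  assumes "0 \<le> s" "s \<le> t" "t \<le> 1" "0 \<le> L" "L \<le> M" "M \<le> 1"
  shows "contraction_ratio L s \<le> contraction_ratio M t"
proof -
  have "(t + M) * (1 + L * s) - (s + L) * (1 + M * t) = (t - s) * (1 - L * M) + (M - L) * (1 - s * t)"
    by (simp add: algebra_simps)
  also have "\<dots> \<ge> 0" using assms by (intro add_nonneg_nonneg mult_nonneg_nonneg) (auto simp: mult_le_one)
  finally have "(s + L) * (1 + M * t) \<le> (t + M) * (1 + L * s)" by simp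
  then show ?thesis
    using assms by (simp add: contraction_ratio_def divide_le_eq le_divide_eq add_pos_nonneg)
qed

lemma contraction_ratio_pos: "0 < s \<Longrightarrow> 0 \<le> L \<Longrightarrow> 0 < contraction_ratio L s"
  by (simp add: contraction_ratio_def add_pos_nonneg)

lemma contraction_ratio_less_1:
  assumes "0 \<le> s" "s < 1" "0 \<le> L" "L < 1"
  shows "contraction_ratio L s < 1"
proof -
  have "0 < (1 - s) * (1 - L)" using assms by simp
  then have "s + L < 1 + L * s" by (simp add: algebra_simps)
  then show ?thesis using assms by (simp add: contraction_ratio_def add_pos_nonneg)
qed

context
  fixes L s :: real
  assumes s: "0 < s" "s < 1" and L: "0 \<le> L" "L < 1"
begin

lemma contraction_radius_bounds: "0 < contraction_radius L s n" "contraction_radius L s n \<le> s"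
proof (induction n)
  case (Suc n)
  let ?r = "contraction_radius L s n"
  have q: "0 < contraction_ratio L ?r" "contraction_ratio L ?r < 1"
    using Suc s L contraction_ratio_pos[of ?r L] contraction_ratio_less_1[of ?r L] by auto
  then show "0 < contraction_radius L s (Suc n)" using Suc by simp
  have "?r * contraction_ratio L ?r \<le> ?r * 1" using Suc q by (intro mult_left_mono) auto
  then show "contraction_radius L s (Suc n) \<le> s"
    using Suc unfolding contraction_radius.simps by linarith
qed (use s in auto)

lemma contraction_radius_tendsto_0: "contraction_radius L s \<longlonglongrightarrow> 0"
proof -
  let ?q = "contraction_ratio L s"
  have q: "0 \<le> ?q" "?q < 1"
    using contraction_ratio_pos[of s L] contraction_ratio_less_1[of s L] s L by auto
  have le: "contraction_radius L s n \<le> s * ?q ^ n" for n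
  proof (induction n)
    case (Suc n)
    have "contraction_ratio L (contraction_radius L s n) \<le> ?q"
      using contraction_radius_bounds[of n] s L by (intro contraction_ratio_mono) auto
    then have "contraction_radius L s (Suc n) \<le> (s * ?q ^ n) * ?q"
      unfolding contraction_radius.simps
      using Suc contraction_radius_bounds[of n] s q contraction_ratio_pos[of "contraction_radius L s n" L] L
      by (intro mult_mono) auto
    then show ?case by (simp add: mult_ac)
  qed simp
  show ?thesis
  proof (rule tendsto_sandwich[OF _ _ tendsto_const])
    show "(\<lambda>n. s * ?q ^ n) \<longlonglongrightarrow> 0"
      using q tendsto_mult_left[OF LIMSEQ_power_zero[of ?q], of s] by simp
  qed (use contraction_radius_bounds(1) le in \<open>auto simp: less_imp_le\<close>)
qed

text \<open>As the radii tend to zero, the ratios of successive radii tend to \<open>contraction_ratio L 0 = L\<close>, so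
the radii eventually decay faster than \<open>c ^ n\<close> for any \<open>c > L\<close>. Any \<open>c\<close> strictly between \<open>L\<close> and
\<open>a\<close> leaves room for the constant factor, whose \<open>n\<close>-th root tends to one.\<close>

lemma root_contraction_radius_less:
  assumes a: "L < a" and \<theta>: "0 < \<theta>"
  shows "\<forall>\<^sub>F n in sequentially. root n (contraction_radius L s n / \<theta>) < a"
proof -
  let ?r = "contraction_radius L s"
  define c where "c = (L + a) / 2"
  have c: "L < c" "c < a" "0 < c" using a L by (auto simp: c_def)
  have "(\<lambda>n. contraction_ratio L (?r n)) \<longlonglongrightarrow> (0 + L) / (1 + L * 0)"
    unfolding contraction_ratio_def by (intro tendsto_intros contraction_radius_tendsto_0) auto
  then have "\<forall>\<^sub>F n in sequentially. contraction_ratio L (?r n) < c"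
    using c by (intro order_tendstoD(2)) auto
  then obtain m where m: "\<And>n. n \<ge> m \<Longrightarrow> contraction_ratio L (?r n) < c"
    by (auto simp: eventually_sequentially)
  define B where "B = ?r m / (\<theta> * c ^ m)"
  have B: "B > 0" using contraction_radius_bounds \<theta> c by (simp add: B_def)
  have le: "?r n / \<theta> \<le> B * c ^ n" if "n \<ge> m" for n
    using that
  proof (induction n rule: dec_induct)
    case base
    then show ?case using c \<theta> by (simp add: B_def)
  next
    case (step n)
    have "?r (Suc n) / \<theta> = ?r n / \<theta> * contraction_ratio L (?r n)" by simp
    also have "\<dots> \<le> (B * c ^ n) * c"
      using step m[of n] contraction_radius_bounds[of n] \<theta> B c contraction_ratio_pos[of "?r n" L] L
      by (intro mult_mono) (auto simp: less_imp_le)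
    finally show ?case by (simp add: mult_ac)
  qed
  have "(\<lambda>n. root n B * c) \<longlonglongrightarrow> 1 * c"
    using B by (intro tendsto_intros LIMSEQ_root_const)
  then have "\<forall>\<^sub>F n in sequentially. root n B * c < a"
    using c by (intro order_tendstoD(2)) auto
  then show ?thesis
    using eventually_ge_at_top[of "Suc m"]
  proof eventually_elim
    case (elim n)
    have "root n (?r n / \<theta>) \<le> root n (B * c ^ n)"
      using elim le[of n] by (intro real_root_le_mono) auto
    also have "\<dots> = root n B * c"
      using elim c by (simp add: real_root_mult real_root_power_cancel)
    finally show ?case using elim by simp
  qed
qed

end

lemma disc_map_contraction:
  assumes \<phi>: "disc_map \<phi>" and d: "cmod (deriv \<phi> 0) \<le> L" "L < 1" and z: "cmod z \<le> s" "s < 1"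
  shows "cmod (\<phi> z) \<le> s * contraction_ratio L s"
proof -
  have "cmod (\<phi> z) \<le> cmod z * contraction_ratio (cmod (deriv \<phi> 0)) (cmod z)"
    unfolding contraction_ratio_def using assms by (intro disc_map_Schwarz_Pick) auto
  also have "\<dots> \<le> s * contraction_ratio L s"
    using assms order_trans[OF norm_ge_zero d(1)] order_trans[OF norm_ge_zero z(1)]
    by (intro mult_mono contraction_ratio_mono) (auto simp: contraction_ratio_def)
  finally show ?thesis .
qed

text \<open>The general initial map \<open>g\<close> makes the induction over the word go through; words correspond to
\<open>g = id\<close> and \<open>m = 0\<close>.\<close>

lemma fold_disc_maps:
  assumes \<phi>: "\<And>j. j \<in> A \<Longrightarrow> disc_map (\<phi> j)" "\<And>j. j \<in> A \<Longrightarrow> cmod (deriv (\<phi> j) 0) \<le> L"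
    and L: "0 \<le> L" "L < 1" and s: "0 < s" "s < 1"
    and "set a \<subseteq> A" "disc_map g" "\<And>z. cmod z \<le> s \<Longrightarrow> cmod (g z) \<le> contraction_radius L s m"
  shows "disc_map (fold (\<lambda>i g. \<phi> i \<circ> g) a g) \<and>
     (\<forall>z. cmod z \<le> s \<longrightarrow> cmod (fold (\<lambda>i g. \<phi> i \<circ> g) a g z) \<le> contraction_radius L s (m + length a))"
  using assms(7-9)
proof (induction a arbitrary: g m)
  case Nil
  then show ?case by simp
next
  case (Cons i a)
  have "disc_map (fold (\<lambda>i g. \<phi> i \<circ> g) a (\<phi> i \<circ> g)) \<and>
     (\<forall>z. cmod z \<le> s \<longrightarrow> cmod (fold (\<lambda>i g. \<phi> i \<circ> g) a (\<phi> i \<circ> g) z) \<le> contraction_radius L s (Suc m + length a))"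
  proof (rule Cons.IH)
    show "set a \<subseteq> A" using Cons.prems by simp
    show "disc_map (\<phi> i \<circ> g)" using Cons.prems by (intro disc_map_comp \<phi>) auto
    fix z :: complex assume "cmod z \<le> s"
    then have "cmod (g z) \<le> contraction_radius L s m" by (rule Cons.prems(3))
    moreover have "contraction_radius L s m < 1"
      using contraction_radius_bounds(2)[OF s L, of m] s by simp
    ultimately show "cmod ((\<phi> i \<circ> g) z) \<le> contraction_radius L s (Suc m)"
      unfolding o_apply contraction_radius.simps
      using Cons.prems(1) by (intro disc_map_contraction \<phi> L) auto
  qed
  then show ?case unfolding fold_simps length_Cons add_Suc_right add_Suc .
qed

section \<open>The joint spectral radius\<close>

lemma op_norm_le:
  assumes "(\<lambda>k. 0) \<in> V" "0 \<le> B" "\<And>f. f \<in> V \<Longrightarrow> hf_norm \<theta> (T f) \<le> B * hf_norm \<theta> f"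
  shows "op_norm \<theta> V T \<le> B"
  unfolding op_norm_def
proof (rule cSUP_least)
  have "hf_norm \<theta> (\<lambda>k. 0) \<le> 1" by (simp add: hf_norm_def)
  then show "{f \<in> V. hf_norm \<theta> f \<le> 1} \<noteq> {}" using assms(1) by blast
  fix f assume f: "f \<in> {f \<in> V. hf_norm \<theta> f \<le> 1}"
  then have "hf_norm \<theta> (T f) \<le> B * hf_norm \<theta> f" using assms(3) by simp
  also have "\<dots> \<le> B" using f assms(2) by (simp add: mult_left_le)
  finally show "hf_norm \<theta> (T f) \<le> B" .
qed

lemma op_norm_ge:
  assumes "0 \<le> B" "\<And>f. f \<in> V \<Longrightarrow> hf_norm \<theta> (T f) \<le> B * hf_norm \<theta> f"
    and "f \<in> V" "hf_norm \<theta> f \<le> 1"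
  shows "hf_norm \<theta> (T f) \<le> op_norm \<theta> V T"
  unfolding op_norm_def
proof (rule cSUP_upper)
  show "bdd_above ((\<lambda>f. hf_norm \<theta> (T f)) ` {f \<in> V. hf_norm \<theta> f \<le> 1})"
  proof (rule bdd_aboveI2)
    fix f assume f: "f \<in> {f \<in> V. hf_norm \<theta> f \<le> 1}"
    then have "hf_norm \<theta> (T f) \<le> B * hf_norm \<theta> f" using assms(2) by simp
    also have "\<dots> \<le> B" using f assms(1) by (simp add: mult_left_le)
    finally show "hf_norm \<theta> (T f) \<le> B" .
  qed
qed (use assms in auto)

lemma zero_in_hyperfunctions0: "(\<lambda>k. 0) \<in> hyperfunctions0 \<theta>"
  by (simp add: hyperfunctions0_def hyperfunctions_def)

text \<open>The function \<open>z\<close>, scaled to norm one; it witnesses the lower bound for the norm and the failure of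
surjectivity.\<close>

definition hf_z :: "real \<Rightarrow> int \<Rightarrow> complex" where
  "hf_z \<theta> k = (if k = 1 then 1 / of_real \<theta> else 0)"

lemma hf_z:
  assumes "0 < \<theta>"
  shows "hf_z \<theta> \<in> hyperfunctions0 \<theta>" "hf_norm \<theta> (hf_z \<theta>) \<le> 1"
proof -
  have "L2_set (hf_weighted \<theta> (hf_z \<theta>)) A \<le> 1" if "finite A" for A
  proof -
    have "(\<Sum>k\<in>A. (hf_weighted \<theta> (hf_z \<theta>) k)\<^sup>2) = (\<Sum>k\<in>A. if k = 1 then 1 else 0)"
      using assms by (intro sum.cong) (auto simp: hf_weighted_def hf_z_def norm_divide)
    also have "\<dots> \<le> 1" using that by simp
    finally show ?thesis by (simp add: L2_set_def)
  qed
  then have "hf_z \<theta> \<in> hyperfunctions \<theta>" "hf_norm \<theta> (hf_z \<theta>) \<le> 1"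
    using hf_norm_bound[of \<theta> "hf_z \<theta>" 1] by auto
  then show "hf_z \<theta> \<in> hyperfunctions0 \<theta>" "hf_norm \<theta> (hf_z \<theta>) \<le> 1"
    by (auto simp: hyperfunctions0_def hf_z_def)
qed

lemma koopman_apply:
  assumes \<phi>: "disc_map \<phi>" and \<theta>: "0 < \<theta>" "\<theta> < 1" and f: "f \<in> hyperfunctions \<theta>"
  shows "koopman \<theta> \<phi> f = comp_op (fps_expansion \<phi> 0) f" and "koopman \<theta> \<phi> f \<in> hyperfunctions \<theta>"
proof -
  show eq: "koopman \<theta> \<phi> f = comp_op (fps_expansion \<phi> 0) f"
    using koopman_eq[OF \<phi> \<theta>] f by simp
  show "koopman \<theta> \<phi> f \<in> hyperfunctions \<theta>"
    unfolding eq using disc_map_Schwarz[OF \<phi>] \<theta> 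
    by (intro comp_op_disc_map_bound(1)[OF \<phi> \<theta> _ f]) auto
qed

text \<open>The basic estimate: shrinking of discs by \<open>\<phi>\<close> becomes a change of weights for the operator.\<close>

lemma koopman_bound:
  assumes \<phi>: "disc_map \<phi>" and \<theta>: "0 < \<theta>" "\<theta> < 1" and s: "0 < s" "s \<le> \<theta>" and r: "0 \<le> r" "r \<le> \<theta>"
    and \<phi>r: "\<And>z. cmod z = s \<Longrightarrow> cmod (\<phi> z) \<le> r" and f: "f \<in> hyperfunctions0 \<theta>"
  shows "hf_norm s (koopman \<theta> \<phi> f) \<le> hf_norm r f"
proof -
  have "f \<in> hyperfunctions r"
    using f hyperfunctions0_mono[OF f r] by (simp add: hyperfunctions0_def)
  then show ?thesis
    using comp_op_disc_map_bound(2)[OF \<phi> s(1) _ \<phi>r] koopman_apply(1)[OF \<phi> \<theta>] s \<theta> f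
    by (simp add: hyperfunctions0_def)
qed

lemma koopman_bound0:
  assumes \<phi>: "disc_map \<phi>" and \<theta>: "0 < \<theta>" "\<theta> < 1" and r: "0 \<le> r" "r \<le> \<theta>"
    and \<phi>r: "\<And>z. cmod z \<le> \<theta> \<Longrightarrow> cmod (\<phi> z) \<le> r" and f: "f \<in> hyperfunctions0 \<theta>"
  shows "hf_norm \<theta> (koopman \<theta> \<phi> f) \<le> r / \<theta> * hf_norm \<theta> f"
proof -
  have "hf_norm \<theta> (koopman \<theta> \<phi> f) \<le> hf_norm r f"
    using assms by (intro koopman_bound) auto
  also have "\<dots> \<le> r / \<theta> * hf_norm \<theta> f"
    using assms by (intro hf_norm_shrink) auto
  finally show ?thesis .
qed

text \<open>The coefficient of \<open>z\<close> in \<open>\<phi>\<close> is \<open>deriv \<phi> 0\<close>, and it is visible in the image of the function \<open>z\<close>.\<close>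

lemma koopman_norm_ge:
  assumes \<phi>: "disc_map \<phi>" and \<theta>: "0 < \<theta>" "\<theta> < 1"
  shows "cmod (deriv \<phi> 0) \<le> op_norm \<theta> (hyperfunctions0 \<theta>) (koopman \<theta> \<phi>)"
proof -
  let ?G = "fps_expansion \<phi> 0"
  have z: "hf_z \<theta> \<in> hyperfunctions \<theta>" using hf_z(1)[OF \<theta>(1)] by (simp add: hyperfunctions0_def)
  have "koopman \<theta> \<phi> (hf_z \<theta>) 1 = comp_op ?G (hf_z \<theta>) (int 1)"
    using koopman_apply(1)[OF \<phi> \<theta> z] by simp
  also have "\<dots> = deriv \<phi> 0 / \<theta>"
    unfolding comp_op_pos using disc_map_fps(4)[OF \<phi>]
    by (simp add: fps_compose_nth fps_pos_def hf_z_def)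
  finally have "cmod (deriv \<phi> 0) = L2_set (hf_weighted \<theta> (koopman \<theta> \<phi> (hf_z \<theta>))) {1}"
    using \<theta> by (simp add: hf_weighted_def norm_divide)
  also have "\<dots> \<le> hf_norm \<theta> (koopman \<theta> \<phi> (hf_z \<theta>))"
  proof (rule L2_set_le_hf_norm)
    show "koopman \<theta> \<phi> (hf_z \<theta>) \<in> hyperfunctions \<theta>"
      by (rule koopman_apply(2)[OF \<phi> \<theta> z])
  qed simp
  also have "\<dots> \<le> op_norm \<theta> (hyperfunctions0 \<theta>) (koopman \<theta> \<phi>)"
  proof (rule op_norm_ge)
    fix f assume f: "f \<in> hyperfunctions0 \<theta>"
    show "hf_norm \<theta> (koopman \<theta> \<phi> f) \<le> \<theta> / \<theta> * hf_norm \<theta> f"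
    proof (rule koopman_bound0[OF \<phi> \<theta> _ _ _ f])
      fix z :: complex assume "cmod z \<le> \<theta>"
      then show "cmod (\<phi> z) \<le> \<theta>" using disc_map_Schwarz[OF \<phi>, of z] \<theta> by simp
    qed (use \<theta> in auto)
  qed (use \<theta> hf_z in auto)
  finally show ?thesis .
qed

lemma deriv_fold_replicate:
  assumes "disc_map (\<phi> j)"
  shows "(fold (\<lambda>i g. \<phi> i \<circ> g) (replicate n j) id has_field_derivative deriv (\<phi> j) 0 ^ n) (at 0)
     \<and> fold (\<lambda>i g. \<phi> i \<circ> g) (replicate n j) id 0 = 0"
proof (induction n)
  case 0
  then show ?case by (auto simp: id_def)
next
  case (Suc n)
  let ?F = "fold (\<lambda>i g. \<phi> i \<circ> g) (replicate n j) id"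
  have e: "fold (\<lambda>i g. \<phi> i \<circ> g) (replicate (Suc n) j) id = \<phi> j \<circ> ?F"
    unfolding replicate_Suc replicate_append_same[symmetric] by simp
  have "(\<phi> j has_field_derivative deriv (\<phi> j) 0) (at 0)"
    using assms by (intro holomorphic_derivI[of _ "ball 0 1"]) (auto simp: disc_map_def)
  moreover have F: "(?F has_field_derivative deriv (\<phi> j) 0 ^ n) (at 0)" "?F 0 = 0"
    using Suc by blast+
  ultimately have "(\<phi> j \<circ> ?F has_field_derivative deriv (\<phi> j) 0 * deriv (\<phi> j) 0 ^ n) (at 0)"
    by (intro DERIV_chain[OF _ F(1)]) (simp only: F(2))
  moreover have "(\<phi> j \<circ> ?F) 0 = 0" using F(2) assms by (simp only: o_apply disc_map_def)
  ultimately show ?case unfolding e power_Suc by blast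
qed

text \<open>All words of length \<open>n\<close> obey the upper bound given by the contraction radii; the power of a single
letter with maximal derivative attains the lower bound.\<close>

lemma joint_spectral_radius:
  fixes \<theta> :: real and N :: nat and \<phi> :: "nat \<Rightarrow> complex \<Rightarrow> complex"
  assumes \<theta>: "0 < \<theta>" "\<theta> < 1" and N: "1 \<le> N"
    and \<phi>: "\<And>j. j \<in> {1..N} \<Longrightarrow> disc_map (\<phi> j)"
    and d: "\<And>j. j \<in> {1..N} \<Longrightarrow> cmod (deriv (\<phi> j) 0) < 1"
  shows "(\<lambda>n. MAX a\<in>words N n. root n (op_norm \<theta> (hyperfunctions0 \<theta>) (koopman \<theta> (word_map \<phi> a))))
           \<longlonglongrightarrow> (MAX j\<in>{1..N}. cmod (deriv (\<phi> j) 0))"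
proof -
  let ?V = "hyperfunctions0 \<theta>"
  define L where "L = (MAX j\<in>{1..N}. cmod (deriv (\<phi> j) 0))"
  have "L \<in> (\<lambda>j. cmod (deriv (\<phi> j) 0)) ` {1..N}"
    unfolding L_def using N by (intro Max_in) auto
  then obtain i where i: "i \<in> {1..N}" "L = cmod (deriv (\<phi> i) 0)" by auto
  have L: "0 \<le> L" "L < 1" using i d by auto
  have dL: "cmod (deriv (\<phi> j) 0) \<le> L" if "j \<in> {1..N}" for j
    unfolding L_def using that by (intro Max_ge) auto
  let ?w = "\<lambda>n. (\<lambda>a. root n (op_norm \<theta> ?V (koopman \<theta> (word_map \<phi> a)))) ` words N n"
  have fin: "finite (?w n)" for n
    using finite_lists_length_eq[of "{1..N}" n] unfolding words_def
    by (intro finite_imageI) (simp add: conj_commute)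
  have rep: "replicate n i \<in> words N n" for n using i by (auto simp: words_def)
  have word: "disc_map (word_map \<phi> a) \<and> (\<forall>z. cmod z \<le> \<theta> \<longrightarrow> cmod (word_map \<phi> a z) \<le> contraction_radius L \<theta> n)"
    if "a \<in> words N n" for a n
    using fold_disc_maps[of "{1..N}" \<phi> L \<theta> a id 0] \<phi> dL L \<theta> that disc_map_id
    by (simp add: word_map_def words_def)
  have upper: "op_norm \<theta> ?V (koopman \<theta> (word_map \<phi> a)) \<le> contraction_radius L \<theta> n / \<theta>"
    if a: "a \<in> words N n" for a n
  proof (rule op_norm_le)
    show "0 \<le> contraction_radius L \<theta> n / \<theta>"
      using contraction_radius_bounds(1)[OF \<theta> L, of n] \<theta> by simp
    fix f assume "f \<in> ?V"
    then show "hf_norm \<theta> (koopman \<theta> (word_map \<phi> a) f) \<le> contraction_radius L \<theta> n / \<theta> * hf_norm \<theta> f"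
      using word[OF a] contraction_radius_bounds[OF \<theta> L, of n] \<theta> by (intro koopman_bound0) auto
  qed (rule zero_in_hyperfunctions0)
  have lower: "L ^ n \<le> op_norm \<theta> ?V (koopman \<theta> (word_map \<phi> (replicate n i)))" for n
  proof -
    have "deriv (word_map \<phi> (replicate n i)) 0 = deriv (\<phi> i) 0 ^ n"
      unfolding word_map_def using deriv_fold_replicate[of \<phi> i n] \<phi>[OF i(1)] by (intro DERIV_imp_deriv) auto
    then show ?thesis
      using koopman_norm_ge[OF _ \<theta>, of "word_map \<phi> (replicate n i)"] word[OF rep, of n] i
      by (simp add: norm_power)
  qed
  show ?thesis
    unfolding L_def[symmetric]
  proof (rule order_tendstoI)
    fix a assume a: "a < L"
    show "\<forall>\<^sub>F n in sequentially. a < Max (?w n)"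
      using eventually_gt_at_top[of 0]
    proof eventually_elim
      case (elim n)
      note a
      also have "L = root n (L ^ n)" using elim L by (simp add: real_root_power_cancel)
      also have "\<dots> \<le> root n (op_norm \<theta> ?V (koopman \<theta> (word_map \<phi> (replicate n i))))"
        using elim lower by (intro real_root_le_mono) auto
      also have "\<dots> \<le> Max (?w n)" using rep by (intro Max_ge fin) auto
      finally show ?case .
    qed
  next
    fix a assume "L < a"
    from root_contraction_radius_less[OF \<theta> L this \<theta>(1)] eventually_gt_at_top[of 0]
    show "\<forall>\<^sub>F n in sequentially. Max (?w n) < a"
    proof eventually_elim
      case (elim n)
      have "x < a" if x: "x \<in> ?w n" for x
      proof -
        obtain b where b: "b \<in> words N n" "x = root n (op_norm \<theta> ?V (koopman \<theta> (word_map \<phi> b)))"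
          using x by blast
        have "x \<le> root n (contraction_radius L \<theta> n / \<theta>)"
          unfolding b(2) using elim upper[OF b(1)] by (intro real_root_le_mono) auto
        then show ?thesis using elim by simp
      qed
      then show ?case using rep[of n] by (subst Max_less_iff[OF fin]) auto
    qed
  qed
qed

section \<open>Quasi-nilpotence\<close>

lemma hyperfunctions0_lin:
  assumes "f \<in> hyperfunctions0 \<theta>" "g \<in> hyperfunctions0 \<theta>" "0 < \<theta>"
  shows "(\<lambda>k. f k + c * g k) \<in> hyperfunctions0 \<theta>"
    and "hf_norm \<theta> (\<lambda>k. f k + c * g k) \<le> hf_norm \<theta> f + cmod c * hf_norm \<theta> g"
proof -
  have f: "f \<in> hyperfunctions \<theta>" and g: "g \<in> hyperfunctions \<theta>" "(\<lambda>k. c * g k) \<in> hyperfunctions \<theta>"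
    using assms hf_norm_scale(1) by (auto simp: hyperfunctions0_def)
  show "(\<lambda>k. f k + c * g k) \<in> hyperfunctions0 \<theta>"
    using hf_norm_add(1)[OF f g(2)] assms by (simp add: hyperfunctions0_def)
  have "hf_norm \<theta> (\<lambda>k. f k + c * g k) \<le> hf_norm \<theta> f + hf_norm \<theta> (\<lambda>k. c * g k)"
    using hf_norm_add(2)[OF f g(2)] assms by simp
  also have "\<dots> \<le> hf_norm \<theta> f + cmod c * hf_norm \<theta> g"
    using hf_norm_scale(2)[OF g(1)] assms by simp
  finally show "hf_norm \<theta> (\<lambda>k. f k + c * g k) \<le> hf_norm \<theta> f + cmod c * hf_norm \<theta> g" .
qed

lemma hyperfunctions0_scale:
  assumes "f \<in> hyperfunctions0 \<theta>" "0 < \<theta>"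
  shows "(\<lambda>k. c * f k) \<in> hyperfunctions0 \<theta>"
  using hyperfunctions0_lin(1)[OF zero_in_hyperfunctions0 assms] by simp

lemma bounded_op_lin:
  assumes T: "bounded_op \<theta> (hyperfunctions0 \<theta>) T" and \<theta>: "0 < \<theta>"
    and f: "f \<in> hyperfunctions0 \<theta>" and g: "g \<in> hyperfunctions0 \<theta>"
  shows "T (\<lambda>k. f k + c * g k) = (\<lambda>k. T f k + c * T g k)"
  using bounded_op_add[OF T f hyperfunctions0_scale[OF g \<theta>]] bounded_op_scale[OF T g] by simp

text \<open>The linear operators on \<open>hyperfunctions0 \<theta>\<close> with the two properties that a Koopman operator inherits
from \<open>deriv \<phi> 0 = 0\<close>: the bound \<open>\<bar>\<phi> z\<bar> \<le> \<bar>z\<bar>\<^sup>2\<close> appears as a bound by the norm of the squared radius,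
simultaneously for all radii, and the double zero appears as strict triangularity of the matrix.
Both properties survive sums and products. A norm bound at the single radius \<open>\<theta>\<close> would only give
geometric growth of the powers, whereas a bound for all radii can be iterated.\<close>

definition superattracting_op :: "real \<Rightarrow> hf_op \<Rightarrow> bool" where
  "superattracting_op \<theta> T \<longleftrightarrow>
     (\<forall>f\<in>hyperfunctions0 \<theta>. T f \<in> hyperfunctions0 \<theta>) \<and>
     (\<forall>f\<in>hyperfunctions0 \<theta>. \<forall>g\<in>hyperfunctions0 \<theta>. T (\<lambda>k. f k + g k) = (\<lambda>k. T f k + T g k)) \<and>
     (\<forall>c. \<forall>f\<in>hyperfunctions0 \<theta>. T (\<lambda>k. c * f k) = (\<lambda>k. c * T f k)) \<and>
     (\<exists>C\<ge>0. \<forall>f\<in>hyperfunctions0 \<theta>. \<forall>s. 0 < s \<longrightarrow> s \<le> \<theta> \<longrightarrow> hf_norm s (T f) \<le> C * hf_norm (s\<^sup>2) f) \<and>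
     (\<forall>f\<in>hyperfunctions0 \<theta>. \<forall>m::nat. (\<forall>k. \<bar>k\<bar> \<le> int m \<longrightarrow> f k = 0) \<longrightarrow>
        (\<forall>k. \<bar>k\<bar> \<le> int (Suc m) \<longrightarrow> T f k = 0))"

context
  fixes \<theta> :: real
  assumes \<theta>: "0 < \<theta>" "\<theta> < 1"
begin

private abbreviation (input) "V \<equiv> hyperfunctions0 \<theta>"

lemma square_radius: "0 < s \<Longrightarrow> s \<le> \<theta> \<Longrightarrow> 0 < s\<^sup>2 \<and> s\<^sup>2 \<le> s"
  using \<theta> by (auto simp: power2_eq_square mult_left_le)

lemma hyperfunctions0_radius: "f \<in> V \<Longrightarrow> 0 < s \<Longrightarrow> s \<le> \<theta> \<Longrightarrow> f \<in> hyperfunctions s"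
  using hyperfunctions0_mono[of f \<theta> s] by (simp add: hyperfunctions0_def)

lemma superattracting_op_closed: "superattracting_op \<theta> T \<Longrightarrow> f \<in> V \<Longrightarrow> T f \<in> V"
  by (simp add: superattracting_op_def)

lemma superattracting_op_bound:
  assumes "superattracting_op \<theta> T"
  obtains C where "C \<ge> 0"
    "\<And>f s. f \<in> V \<Longrightarrow> 0 < s \<Longrightarrow> s \<le> \<theta> \<Longrightarrow> hf_norm s (T f) \<le> C * hf_norm (s\<^sup>2) f"
  using assms unfolding superattracting_op_def by blast

lemma superattracting_op_vanishing:
  assumes "superattracting_op \<theta> T" "f \<in> V" "\<And>k. \<bar>k\<bar> \<le> int m \<Longrightarrow> f k = 0" "\<bar>k\<bar> \<le> int (Suc m)"
  shows "T f k = 0"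
  using assms unfolding superattracting_op_def by blast

lemma superattracting_op_bounded:
  assumes T: "superattracting_op \<theta> T"
  shows "bounded_op \<theta> V T"
proof -
  obtain C where C: "C \<ge> 0" "\<And>f s. f \<in> V \<Longrightarrow> 0 < s \<Longrightarrow> s \<le> \<theta> \<Longrightarrow> hf_norm s (T f) \<le> C * hf_norm (s\<^sup>2) f"
    using superattracting_op_bound[OF T] by blast
  have "hf_norm \<theta> (T f) \<le> C * hf_norm \<theta> f" if f: "f \<in> V" for f
  proof -
    have "hf_norm \<theta> (T f) \<le> C * hf_norm (\<theta>\<^sup>2) f" using C(2)[OF f] \<theta> by simp
    also have "\<dots> \<le> C * hf_norm \<theta> f"
      using C(1) f square_radius[of \<theta>] \<theta> by (intro mult_left_mono hf_norm_mono(2)) (auto simp: hyperfunctions0_def)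
    finally show ?thesis .
  qed
  then show ?thesis using T unfolding bounded_op_def superattracting_op_def by blast
qed

lemma superattracting_op_add:
  assumes S: "superattracting_op \<theta> S" and T: "superattracting_op \<theta> T"
  shows "superattracting_op \<theta> (\<lambda>f k. S f k + T f k)"
  unfolding superattracting_op_def
proof (intro conjI ballI allI impI)
  note [simp] = superattracting_op_closed[OF S] superattracting_op_closed[OF T]
  note S' = superattracting_op_bounded[OF S] and T' = superattracting_op_bounded[OF T]
  obtain C where C: "C \<ge> 0" "\<And>f s. f \<in> V \<Longrightarrow> 0 < s \<Longrightarrow> s \<le> \<theta> \<Longrightarrow> hf_norm s (S f) \<le> C * hf_norm (s\<^sup>2) f"
    using superattracting_op_bound[OF S] by blast
  obtain D where D: "D \<ge> 0" "\<And>f s. f \<in> V \<Longrightarrow> 0 < s \<Longrightarrow> s \<le> \<theta> \<Longrightarrow> hf_norm s (T f) \<le> D * hf_norm (s\<^sup>2) f"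
    using superattracting_op_bound[OF T] by blast
  show "(\<lambda>k. S f k + T f k) \<in> V" if "f \<in> V" for f
    using hyperfunctions0_lin(1)[of "S f" \<theta> "T f" 1] that \<theta> by simp
  show "(\<lambda>k. S (\<lambda>k. f k + g k) k + T (\<lambda>k. f k + g k) k) = (\<lambda>k. S f k + T f k + (S g k + T g k))"
    if "f \<in> V" "g \<in> V" for f g
    using bounded_op_add[OF S' that] bounded_op_add[OF T' that] by (simp add: algebra_simps)
  show "(\<lambda>k. S (\<lambda>k. c * f k) k + T (\<lambda>k. c * f k) k) = (\<lambda>k. c * (S f k + T f k))" if "f \<in> V" for c f
    using bounded_op_scale[OF S' that] bounded_op_scale[OF T' that] by (simp add: algebra_simps)
  show "\<exists>C\<ge>0. \<forall>f\<in>V. \<forall>s. 0 < s \<longrightarrow> s \<le> \<theta> \<longrightarrow> hf_norm s (\<lambda>k. S f k + T f k) \<le> C * hf_norm (s\<^sup>2) f"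
  proof (intro exI[of _ "C + D"] conjI ballI allI impI)
    fix f s assume f: "f \<in> V" and s: "0 < s" "s \<le> \<theta>"
    have "hf_norm s (\<lambda>k. S f k + T f k) \<le> hf_norm s (S f) + hf_norm s (T f)"
      using f s by (intro hf_norm_add(2) hyperfunctions0_radius) auto
    also have "\<dots> \<le> C * hf_norm (s\<^sup>2) f + D * hf_norm (s\<^sup>2) f"
      using C(2)[OF f s] D(2)[OF f s] by simp
    finally show "hf_norm s (\<lambda>k. S f k + T f k) \<le> (C + D) * hf_norm (s\<^sup>2) f"
      by (simp add: algebra_simps)
  qed (use C D in auto)
  show "S f k + T f k = 0" if "f \<in> V" "\<forall>k. \<bar>k\<bar> \<le> int m \<longrightarrow> f k = 0" "\<bar>k\<bar> \<le> int (Suc m)" for f m k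
    using superattracting_op_vanishing[OF S that(1) _ that(3)] superattracting_op_vanishing[OF T that(1) _ that(3)] that(2)
    by simp
qed

lemma superattracting_op_scale:
  assumes T: "superattracting_op \<theta> T"
  shows "superattracting_op \<theta> (\<lambda>f k. c * T f k)"
  unfolding superattracting_op_def
proof (intro conjI ballI allI impI)
  note [simp] = superattracting_op_closed[OF T]
  note T' = superattracting_op_bounded[OF T]
  obtain C where C: "C \<ge> 0" "\<And>f s. f \<in> V \<Longrightarrow> 0 < s \<Longrightarrow> s \<le> \<theta> \<Longrightarrow> hf_norm s (T f) \<le> C * hf_norm (s\<^sup>2) f"
    using superattracting_op_bound[OF T] by blast
  show "(\<lambda>k. c * T f k) \<in> V" if "f \<in> V" for f
    using that \<theta> by (intro hyperfunctions0_scale) auto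
  show "(\<lambda>k. c * T (\<lambda>k. f k + g k) k) = (\<lambda>k. c * T f k + c * T g k)" if "f \<in> V" "g \<in> V" for f g
    using bounded_op_add[OF T' that] by (simp add: algebra_simps)
  show "(\<lambda>k. c * T (\<lambda>k. d * f k) k) = (\<lambda>k. d * (c * T f k))" if "f \<in> V" for d f
    using bounded_op_scale[OF T' that] by (simp add: algebra_simps)
  show "\<exists>C\<ge>0. \<forall>f\<in>V. \<forall>s. 0 < s \<longrightarrow> s \<le> \<theta> \<longrightarrow> hf_norm s (\<lambda>k. c * T f k) \<le> C * hf_norm (s\<^sup>2) f"
  proof (intro exI[of _ "cmod c * C"] conjI ballI allI impI)
    fix f s assume f: "f \<in> V" and s: "0 < s" "s \<le> \<theta>"
    have "hf_norm s (\<lambda>k. c * T f k) \<le> cmod c * hf_norm s (T f)"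
      using f s by (intro hf_norm_scale(2) hyperfunctions0_radius) auto
    also have "\<dots> \<le> cmod c * (C * hf_norm (s\<^sup>2) f)"
      using C(2)[OF f s] by (intro mult_left_mono) auto
    finally show "hf_norm s (\<lambda>k. c * T f k) \<le> (cmod c * C) * hf_norm (s\<^sup>2) f"
      by (simp add: algebra_simps)
  qed (use C in auto)
  show "c * T f k = 0" if "f \<in> V" "\<forall>k. \<bar>k\<bar> \<le> int m \<longrightarrow> f k = 0" "\<bar>k\<bar> \<le> int (Suc m)" for f m k
    using superattracting_op_vanishing[OF T that(1) _ that(3)] that(2) by simp
qed

text \<open>Composition would even give the fourth power of the radius, which is estimated by the square so
that the class is closed under products.\<close>

lemma superattracting_op_comp:
  assumes S: "superattracting_op \<theta> S" and T: "superattracting_op \<theta> T"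
  shows "superattracting_op \<theta> (S \<circ> T)"
  unfolding superattracting_op_def o_apply
proof (intro conjI ballI allI impI)
  note [simp] = superattracting_op_closed[OF S] superattracting_op_closed[OF T]
  note S' = superattracting_op_bounded[OF S] and T' = superattracting_op_bounded[OF T]
  obtain C where C: "C \<ge> 0" "\<And>f s. f \<in> V \<Longrightarrow> 0 < s \<Longrightarrow> s \<le> \<theta> \<Longrightarrow> hf_norm s (S f) \<le> C * hf_norm (s\<^sup>2) f"
    using superattracting_op_bound[OF S] by blast
  obtain D where D: "D \<ge> 0" "\<And>f s. f \<in> V \<Longrightarrow> 0 < s \<Longrightarrow> s \<le> \<theta> \<Longrightarrow> hf_norm s (T f) \<le> D * hf_norm (s\<^sup>2) f"
    using superattracting_op_bound[OF T] by blast
  show "S (T f) \<in> V" if "f \<in> V" for f using that by simp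
  show "S (T (\<lambda>k. f k + g k)) = (\<lambda>k. S (T f) k + S (T g) k)" if "f \<in> V" "g \<in> V" for f g
    using bounded_op_add[OF T' that] bounded_op_add[OF S', of "T f" "T g"] that by simp
  show "S (T (\<lambda>k. c * f k)) = (\<lambda>k. c * S (T f) k)" if "f \<in> V" for c f
    using bounded_op_scale[OF T' that] bounded_op_scale[OF S', of "T f"] that by simp
  show "\<exists>C\<ge>0. \<forall>f\<in>V. \<forall>s. 0 < s \<longrightarrow> s \<le> \<theta> \<longrightarrow> hf_norm s (S (T f)) \<le> C * hf_norm (s\<^sup>2) f"
  proof (intro exI[of _ "C * D"] conjI ballI allI impI)
    fix f s assume f: "f \<in> V" and s: "0 < s" "s \<le> \<theta>"
    note s2 = square_radius[OF s]
    have s4: "(s\<^sup>2)\<^sup>2 \<le> s\<^sup>2" using square_radius[of "s\<^sup>2"] s2 s by simp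
    have "hf_norm s (S (T f)) \<le> C * hf_norm (s\<^sup>2) (T f)"
      using f s by (intro C(2)) auto
    also have "\<dots> \<le> C * (D * hf_norm ((s\<^sup>2)\<^sup>2) f)"
      using f s s2 C by (intro mult_left_mono D(2)) auto
    also have "\<dots> \<le> C * (D * hf_norm (s\<^sup>2) f)"
      using f s s2 s4 C D by (intro mult_left_mono hf_norm_mono(2) hyperfunctions0_radius) auto
    finally show "hf_norm s (S (T f)) \<le> C * D * hf_norm (s\<^sup>2) f" by (simp add: algebra_simps)
  qed (use C D in auto)
  show "S (T f) k = 0" if f: "f \<in> V" "\<forall>k. \<bar>k\<bar> \<le> int m \<longrightarrow> f k = 0" and k: "\<bar>k\<bar> \<le> int (Suc m)" for f m k
  proof (rule superattracting_op_vanishing[OF S _ _ k])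
    show "T f j = 0" if "\<bar>j\<bar> \<le> int m" for j
      using superattracting_op_vanishing[OF T f(1), of m j] f(2) that by simp
  qed (use f in simp)
qed

text \<open>For vanishing derivative the Schwarz--Pick factor at radius \<open>s\<close> is \<open>s\<close> itself, and a power series
with a double zero has \<open>k\<close>-th power starting at degree \<open>2 k\<close>.\<close>

lemma superattracting_op_koopman:
  assumes \<phi>: "disc_map \<phi>" and d: "deriv \<phi> 0 = 0"
  shows "superattracting_op \<theta> (koopman \<theta> \<phi>)"
  unfolding superattracting_op_def
proof (intro conjI ballI allI impI)
  define G where "G = fps_expansion \<phi> 0"
  have G: "G $ 0 = 0" "G $ Suc 0 = 0" using disc_map_fps(3,4)[OF \<phi>] d by (simp_all add: G_def)
  have eq: "koopman \<theta> \<phi> f = comp_op G f" if "f \<in> V" for f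
    using koopman_apply(1)[OF \<phi> \<theta>] that by (simp add: G_def hyperfunctions0_def)
  show "koopman \<theta> \<phi> f \<in> V" if f: "f \<in> V" for f
    using koopman_apply(2)[OF \<phi> \<theta>, of f] f eq[OF f] comp_op_0[of G f] by (simp add: hyperfunctions0_def)
  show "koopman \<theta> \<phi> (\<lambda>k. f k + g k) = (\<lambda>k. koopman \<theta> \<phi> f k + koopman \<theta> \<phi> g k)" if "f \<in> V" "g \<in> V" for f g
    using hyperfunctions0_lin(1)[OF that \<theta>(1), of 1] that by (simp add: eq comp_op_add)
  show "koopman \<theta> \<phi> (\<lambda>k. c * f k) = (\<lambda>k. c * koopman \<theta> \<phi> f k)" if "f \<in> V" for c f
    using hyperfunctions0_scale[OF that \<theta>(1), of c] that by (simp add: eq comp_op_scale)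
  show "\<exists>C\<ge>0. \<forall>f\<in>V. \<forall>s. 0 < s \<longrightarrow> s \<le> \<theta> \<longrightarrow> hf_norm s (koopman \<theta> \<phi> f) \<le> C * hf_norm (s\<^sup>2) f"
  proof (intro exI[of _ 1] conjI ballI allI impI)
    fix f s assume f: "f \<in> V" and s: "0 < s" "s \<le> \<theta>"
    have "cmod (\<phi> z) \<le> s\<^sup>2" if "cmod z = s" for z
      using disc_map_contraction[OF \<phi>, of 0 z s] d that s \<theta> by (simp add: contraction_ratio_def power2_eq_square)
    then have "hf_norm s (koopman \<theta> \<phi> f) \<le> hf_norm (s\<^sup>2) f"
      using square_radius[OF s] s by (intro koopman_bound[OF \<phi> \<theta>] f) auto
    then show "hf_norm s (koopman \<theta> \<phi> f) \<le> 1 * hf_norm (s\<^sup>2) f" by simp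
  qed simp
  show "koopman \<theta> \<phi> f k = 0"
    if f: "f \<in> V" and m: "\<forall>k. \<bar>k\<bar> \<le> int m \<longrightarrow> f k = 0" and k: "\<bar>k\<bar> \<le> int (Suc m)" for f m k
  proof -
    have *: "(F oo G) $ n = 0" if F: "\<And>i. i \<le> m \<Longrightarrow> F $ i = 0" and n: "n \<le> Suc m" for F n
      unfolding fps_compose_nth
    proof (rule sum.neutral, rule ballI)
      fix i assume i: "i \<in> {0..n}"
      show "F $ i * (G ^ i) $ n = 0"
      proof (cases "i \<le> m")
        case False
        then have "i = n" "n = Suc m" using i n by auto
        then show ?thesis using startsby_zero_power_nth_same[OF G(1), of n] G by simp
      qed (simp add: F)
    qed
    show ?thesis
      using k m by (auto simp: eq[OF f] comp_op_def fps_pos_def fps_neg_def intro!: *)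
  qed
qed

text \<open>The radius is squared in every step while the constant only grows geometrically, which is why the
spectral radius is zero for arbitrary \<open>C\<close>.\<close>

lemma superattracting_op_funpow_bound:
  assumes T: "superattracting_op \<theta> T"
    and C: "C \<ge> 0" "\<And>f s. f \<in> V \<Longrightarrow> 0 < s \<Longrightarrow> s \<le> \<theta> \<Longrightarrow> hf_norm s (T f) \<le> C * hf_norm (s\<^sup>2) f"
    and f: "f \<in> V" and s: "0 < s" "s \<le> \<theta>"
  shows "(T ^^ m) f \<in> V \<and> hf_norm s ((T ^^ m) f) \<le> C ^ m * hf_norm (s ^ (2 ^ m)) f"
  using s
proof (induction m arbitrary: s)
  case 0
  then show ?case using f by simp
next
  case (Suc m)
  note s2 = square_radius[OF Suc.prems]
  have IH: "(T ^^ m) f \<in> V" "hf_norm (s\<^sup>2) ((T ^^ m) f) \<le> C ^ m * hf_norm ((s\<^sup>2) ^ (2 ^ m)) f"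
    using Suc.IH[of "s\<^sup>2"] s2 Suc.prems by auto
  have "hf_norm s (T ((T ^^ m) f)) \<le> C * hf_norm (s\<^sup>2) ((T ^^ m) f)"
    using Suc.prems by (intro C(2) IH(1))
  also have "\<dots> \<le> C * (C ^ m * hf_norm ((s\<^sup>2) ^ (2 ^ m)) f)"
    using IH(2) C(1) by (rule mult_left_mono)
  finally show ?case
    using superattracting_op_closed[OF T IH(1)] by (simp add: power_mult[symmetric] mult.assoc)
qed

lemma superattracting_op_funpow_vanishing:
  assumes T: "superattracting_op \<theta> T" and f: "f \<in> V"
  shows "(T ^^ m) f \<in> V \<and> (\<forall>k. \<bar>k\<bar> \<le> int m \<longrightarrow> (T ^^ m) f k = 0)"
proof (induction m)
  case 0
  then show ?case using f by (simp add: hyperfunctions0_def)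
next
  case (Suc m)
  then show ?case
    using superattracting_op_closed[OF T, of "(T ^^ m) f"]
      superattracting_op_vanishing[OF T, of "(T ^^ m) f" m] by simp
qed

lemma superexponential_summable:
  assumes "C \<ge> 0" "M > 0"
  shows "summable (\<lambda>m. C ^ m * \<theta> ^ (2 ^ m) / M ^ m)"
proof -
  have "(\<lambda>m. C / M * \<theta> ^ (2 ^ m)) \<longlonglongrightarrow> C / M * 0"
  proof (intro tendsto_intros)
    have "\<theta> ^ (2 ^ m) \<le> \<theta> ^ m" for m
      using \<theta> by (intro power_decreasing) (auto intro: less_imp_le less_exp)
    then show "(\<lambda>m. \<theta> ^ (2 ^ m)) \<longlonglongrightarrow> 0"
      using \<theta> by (intro tendsto_sandwich[OF _ _ tendsto_const LIMSEQ_power_zero[of \<theta>]]) auto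
  qed
  then have "\<forall>\<^sub>F m in sequentially. C / M * \<theta> ^ (2 ^ m) < 1 / 2"
    by (intro order_tendstoD(2)) auto
  then obtain m0 where m0: "\<And>m. m \<ge> m0 \<Longrightarrow> C / M * \<theta> ^ (2 ^ m) < 1 / 2"
    by (auto simp: eventually_sequentially)
  show ?thesis
  proof (rule summable_ratio_test[of "1 / 2" m0])
    fix m assume m: "m \<ge> m0"
    have "C ^ Suc m * \<theta> ^ (2 ^ Suc m) / M ^ Suc m = (C / M * \<theta> ^ (2 ^ m)) * (C ^ m * \<theta> ^ (2 ^ m) / M ^ m)"
      by (simp add: mult_2 power_add)
    also have "\<dots> \<le> 1 / 2 * (C ^ m * \<theta> ^ (2 ^ m) / M ^ m)"
      using m0[OF m] assms \<theta> by (intro mult_right_mono) auto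
    finally show "norm (C ^ Suc m * \<theta> ^ (2 ^ Suc m) / M ^ Suc m) \<le> 1 / 2 * norm (C ^ m * \<theta> ^ (2 ^ m) / M ^ m)"
      using assms \<theta> by simp
  qed simp
qed

text \<open>The sign is that of the inverse of \<open>T - \<mu>\<close>, not of \<open>\<mu> - T\<close>.\<close>

definition neumann_sum :: "hf_op \<Rightarrow> complex \<Rightarrow> nat \<Rightarrow> hf_op" where
  "neumann_sum T \<mu> K f k = (\<Sum>m<K. - (1 / \<mu> ^ Suc m) * (T ^^ m) f k)"

lemma neumann_sum_Suc:
  "neumann_sum T \<mu> (Suc K) f = (\<lambda>k. neumann_sum T \<mu> K f k + - (1 / \<mu> ^ Suc K) * (T ^^ K) f k)"
  by (simp add: neumann_sum_def fun_eq_iff)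

text \<open>By strict triangularity \<open>T ^^ m\<close> does not contribute to coefficients of index at most \<open>m\<close>, so the
Neumann series is a finite sum in each coefficient and the algebraic identities reduce to
telescoping sums. Only boundedness of the inverse uses the decay of the norms of the powers.\<close>

lemma superattracting_op_resolvent:
  assumes T: "superattracting_op \<theta> T" and \<mu>: "\<mu> \<noteq> 0"
  shows "\<exists>S. bounded_op \<theta> V S \<and> (\<forall>f\<in>V. S (\<lambda>k. T f k - \<mu> * f k) = f) \<and>
    (\<forall>f\<in>V. (\<lambda>k. T (S f) k - \<mu> * S f k) = f)"
proof -
  let ?R = "neumann_sum T \<mu>"
  note bT = superattracting_op_bounded[OF T]
  note van = superattracting_op_funpow_vanishing[OF T]
  obtain C where C: "C \<ge> 0" "\<And>f s. f \<in> V \<Longrightarrow> 0 < s \<Longrightarrow> s \<le> \<theta> \<Longrightarrow> hf_norm s (T f) \<le> C * hf_norm (s\<^sup>2) f"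
    using superattracting_op_bound[OF T] by blast
  define a where "a m = C ^ m * \<theta> ^ (2 ^ m) / cmod \<mu> ^ m" for m
  define B where "B = suminf a / (\<theta> * cmod \<mu>)"
  have a: "summable a" "\<And>m. a m \<ge> 0"
    unfolding a_def using superexponential_summable[OF C(1), of "cmod \<mu>"] \<mu> C \<theta> by auto
  define S where "S f k = ?R (Suc (nat \<bar>k\<bar>)) f k" for f k
  have S: "S f k = ?R K f k" if f: "f \<in> V" and K: "nat \<bar>k\<bar> < K" for f k K
    unfolding S_def neumann_sum_def
  proof (rule sum.mono_neutral_left)
    show "\<forall>i\<in>{..<K} - {..<Suc (nat \<bar>k\<bar>)}. - (1 / \<mu> ^ Suc i) * (T ^^ i) f k = 0"
      using van[OF f] by auto
  qed (use K in auto)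
  have pow_bound: "hf_norm \<theta> ((T ^^ m) f) \<le> C ^ m * \<theta> ^ (2 ^ m) / \<theta> * hf_norm \<theta> f" if f: "f \<in> V" for f m
  proof -
    have "hf_norm \<theta> ((T ^^ m) f) \<le> C ^ m * hf_norm (\<theta> ^ (2 ^ m)) f"
      using superattracting_op_funpow_bound[OF T C f] \<theta> by simp
    also have "\<dots> \<le> C ^ m * (\<theta> ^ (2 ^ m) / \<theta> * hf_norm \<theta> f)"
      using \<theta> C(1) f power_decreasing[of 1 "2 ^ m" \<theta>]
      by (intro mult_left_mono hf_norm_shrink) auto
    finally show ?thesis by simp
  qed
  have R: "?R K f \<in> V \<and> hf_norm \<theta> (?R K f) \<le> (\<Sum>m<K. a m) / (\<theta> * cmod \<mu>) * hf_norm \<theta> f"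
    if f: "f \<in> V" for f K
  proof (induction K)
    case 0
    have "?R 0 f = (\<lambda>k. 0)" by (simp add: neumann_sum_def fun_eq_iff)
    then show ?case using zero_in_hyperfunctions0 by (simp add: hf_norm_def)
  next
    case (Suc K)
    have "hf_norm \<theta> (?R (Suc K) f) \<le> hf_norm \<theta> (?R K f) + cmod (- (1 / \<mu> ^ Suc K)) * hf_norm \<theta> ((T ^^ K) f)"
      unfolding neumann_sum_Suc using Suc van[OF f] \<theta> by (intro hyperfunctions0_lin(2)) auto
    also have "\<dots> \<le> (\<Sum>m<K. a m) / (\<theta> * cmod \<mu>) * hf_norm \<theta> f
        + cmod (- (1 / \<mu> ^ Suc K)) * (C ^ K * \<theta> ^ (2 ^ K) / \<theta> * hf_norm \<theta> f)"
      using Suc pow_bound[OF f] by (intro add_mono mult_left_mono) auto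
    also have "\<dots> = (\<Sum>m<Suc K. a m) / (\<theta> * cmod \<mu>) * hf_norm \<theta> f"
      using \<theta> \<mu> by (simp add: a_def norm_divide norm_power norm_mult field_simps)
    finally have "hf_norm \<theta> (?R (Suc K) f) \<le> (\<Sum>m<Suc K. a m) / (\<theta> * cmod \<mu>) * hf_norm \<theta> f" .
    moreover have "?R (Suc K) f \<in> V"
      unfolding neumann_sum_Suc using Suc van[OF f] \<theta> by (intro hyperfunctions0_lin(1)) auto
    ultimately show ?case by blast
  qed
  have SV: "S f \<in> V \<and> hf_norm \<theta> (S f) \<le> B * hf_norm \<theta> f" if f: "f \<in> V" for f
  proof -
    have "L2_set (hf_weighted \<theta> (S f)) {- int K..int K} \<le> B * hf_norm \<theta> f" for K
    proof -
      have "L2_set (hf_weighted \<theta> (S f)) {- int K..int K} = L2_set (hf_weighted \<theta> (?R (Suc K) f)) {- int K..int K}"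
        by (intro L2_set_cong refl) (use f in \<open>auto simp: hf_weighted_def S[of f _ "Suc K"]\<close>)
      also have "\<dots> \<le> hf_norm \<theta> (?R (Suc K) f)"
        using R[OF f] by (intro L2_set_le_hf_norm) (auto simp: hyperfunctions0_def)
      also have "\<dots> \<le> (\<Sum>m<Suc K. a m) / (\<theta> * cmod \<mu>) * hf_norm \<theta> f"
        using R[OF f] by blast
      also have "\<dots> \<le> B * hf_norm \<theta> f"
        unfolding B_def using a \<theta> \<mu>
        by (intro mult_right_mono divide_right_mono sum_le_suminf hf_norm_nonneg) auto
      finally show ?thesis .
    qed
    moreover have "S f 0 = 0" using f by (simp add: S_def neumann_sum_def hyperfunctions0_def)
    ultimately show ?thesis
      using hf_norm_bound[of \<theta> "S f" "B * hf_norm \<theta> f"] by (auto simp: hyperfunctions0_def)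
  qed
  have pow_lin: "(T ^^ m) (\<lambda>k. f k + c * g k) = (\<lambda>k. (T ^^ m) f k + c * (T ^^ m) g k)"
    if "f \<in> V" "g \<in> V" for f g c m
  proof (induction m)
    case (Suc m)
    then show ?case
      using bounded_op_lin[OF bT \<theta>(1), of "(T ^^ m) f" "(T ^^ m) g" c] van that by simp
  qed simp
  have S_lin: "S (\<lambda>k. f k + c * g k) = (\<lambda>k. S f k + c * S g k)" if "f \<in> V" "g \<in> V" for f g c
    unfolding S_def neumann_sum_def pow_lin[OF that] sum_distrib_left sum.distrib[symmetric]
    by (intro ext sum.cong refl) (simp add: algebra_simps)
  have telescope: "(\<Sum>m<K. - (1 / \<mu> ^ Suc m) * ((T ^^ Suc m) f k - \<mu> * (T ^^ m) f k)) = f k - (T ^^ K) f k / \<mu> ^ K"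
    for f k K
  proof (induction K)
    case (Suc K)
    have "- (1 / \<mu> ^ Suc K) * ((T ^^ Suc K) f k - \<mu> * (T ^^ K) f k)
        = (T ^^ K) f k / \<mu> ^ K - (T ^^ Suc K) f k / \<mu> ^ Suc K"
      using \<mu> by (simp add: field_simps)
    then show ?case using Suc by (simp only: sum.lessThan_Suc) simp
  qed simp
  have left: "S (\<lambda>k. T f k - \<mu> * f k) = f" if f: "f \<in> V" for f
  proof
    fix k
    have "(\<lambda>k. T f k - \<mu> * f k) = (\<lambda>k. T f k + (- \<mu>) * f k)" by simp
    then have p: "(T ^^ m) (\<lambda>k. T f k - \<mu> * f k) = (\<lambda>k. (T ^^ Suc m) f k - \<mu> * (T ^^ m) f k)" for m
      using pow_lin[OF superattracting_op_closed[OF T f] f, of m "- \<mu>"] by (simp add: funpow_swap1)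
    show "S (\<lambda>k. T f k - \<mu> * f k) k = f k"
      unfolding S_def neumann_sum_def p telescope using van[OF f, of "Suc (nat \<bar>k\<bar>)"] by simp
  qed
  have TR: "T (?R K f) = (\<lambda>k. \<Sum>m<K. - (1 / \<mu> ^ Suc m) * (T ^^ Suc m) f k)" if f: "f \<in> V" for f K
  proof (induction K)
    case 0
    have "?R 0 f = (\<lambda>k. 0 * f k)" by (simp add: neumann_sum_def fun_eq_iff)
    then show ?case using bounded_op_scale[OF bT f, of 0] by simp
  next
    case (Suc K)
    have "?R K f \<in> V" "(T ^^ K) f \<in> V" using R[OF f] van[OF f] by auto
    then show ?case
      unfolding neumann_sum_Suc by (subst bounded_op_lin[OF bT \<theta>(1)]) (simp_all add: Suc fun_eq_iff)
  qed
  have right: "(\<lambda>k. T (S f) k - \<mu> * S f k) = f" if f: "f \<in> V" for f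
  proof
    fix k
    define K where "K = Suc (nat \<bar>k\<bar>)"
    \<comment> \<open>Triangularity replaces an interchange of \<open>T\<close> with the infinite sum: the remainder \<open>D\<close> starts beyond index \<open>\<bar>k\<bar>\<close>.\<close>
    define D where "D = (\<lambda>j. S f j + (- 1) * ?R K f j)"
    have V: "S f \<in> V" "?R K f \<in> V" using SV[OF f] R[OF f] by auto
    have D: "D \<in> V" unfolding D_def using V \<theta> by (intro hyperfunctions0_lin(1)) auto
    have "T D k = 0"
    proof (rule superattracting_op_vanishing[OF T D, of "nat \<bar>k\<bar>"])
      fix j assume "\<bar>j\<bar> \<le> int (nat \<bar>k\<bar>)"
      then show "D j = 0" using S[OF f, of j K] by (simp add: D_def K_def)
    qed simp
    then have "T (S f) k = T (?R K f) k"
      unfolding D_def bounded_op_lin[OF bT \<theta>(1) V] by simp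
    then have "T (S f) k - \<mu> * S f k = T (?R K f) k - \<mu> * ?R K f k"
      using S[OF f, of k K] by (simp add: K_def)
    also have "\<dots> = (\<Sum>m<K. - (1 / \<mu> ^ Suc m) * ((T ^^ Suc m) f k - \<mu> * (T ^^ m) f k))"
      unfolding TR[OF f] neumann_sum_def
      by (simp add: sum_distrib_left sum_subtractf[symmetric] algebra_simps)
    also have "\<dots> = f k"
      unfolding telescope using van[OF f, of K] by (simp add: K_def)
    finally show "T (S f) k - \<mu> * S f k = f k" .
  qed
  have "bounded_op \<theta> V S"
    unfolding bounded_op_def
  proof (intro conjI ballI allI)
    show "S (\<lambda>k. f k + g k) = (\<lambda>k. S f k + S g k)" if "f \<in> V" "g \<in> V" for f g
      using S_lin[OF that, of 1] by simp
    show "S (\<lambda>k. c * f k) = (\<lambda>k. c * S f k)" if "f \<in> V" for c f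
      \<comment> \<open>The multiple is written as \<open>f + (c - 1) f\<close>.\<close>
      using S_lin[OF that that, of "c - 1"] by (simp add: algebra_simps)
    show "\<exists>B. \<forall>f\<in>V. hf_norm \<theta> (S f) \<le> B * hf_norm \<theta> f" using SV by blast
  qed (use SV in auto)
  then show ?thesis using left right by blast
qed

text \<open>Every value of \<open>T\<close> lacks the coefficient at index one, so \<open>T\<close> is not surjective and zero belongs to
the spectrum; hence the supremum defining the spectral radius is taken over exactly \<open>{0}\<close>.\<close>

lemma superattracting_op_quasi_nilpotent:
  assumes T: "superattracting_op \<theta> T"
  shows "quasi_nilpotent \<theta> V T"
proof -
  have z: "hf_z \<theta> \<in> V" using hf_z(1)[OF \<theta>(1)] .
  have "0 \<in> op_spectrum \<theta> V T"
    unfolding op_spectrum_def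
  proof (intro CollectI notI, elim exE conjE)
    fix S assume S: "bounded_op \<theta> V S" "\<forall>f\<in>V. (\<lambda>k. T (S f) k - 0 * S f k) = f"
    have Sz: "S (hf_z \<theta>) \<in> V" using bounded_op_closed[OF S(1) z] .
    have "T (S (hf_z \<theta>)) 1 = 0"
      by (rule superattracting_op_vanishing[OF T Sz, of 0]) (use Sz in \<open>auto simp: hyperfunctions0_def\<close>)
    moreover have "T (S (hf_z \<theta>)) 1 = hf_z \<theta> 1" using S(2) z by (auto simp: fun_eq_iff)
    ultimately show False using \<theta> by (simp add: hf_z_def)
  qed
  moreover have "\<mu> \<notin> op_spectrum \<theta> V T" if "\<mu> \<noteq> 0" for \<mu>
    using superattracting_op_resolvent[OF T that] by (simp add: op_spectrum_def)
  ultimately have "op_spectrum \<theta> V T = {0}" by blast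
  then show ?thesis
    using superattracting_op_bounded[OF T] by (simp add: quasi_nilpotent_def op_spectral_radius_def)
qed

end

section \<open>Polynomials and the generated algebra\<close>

lemma foldr_in_generated_algebra:
  assumes "a \<noteq> []" "set a \<subseteq> A"
  shows "foldr L a \<in> generated_algebra (L ` A)"
  using assms
proof (induction a)
  case (Cons i a)
  have i: "L i \<in> generated_algebra (L ` A)" using Cons.prems by (intro generated_algebra.gen) auto
  show ?case
  proof (cases "a = []")
    case True
    then show ?thesis using i by simp
  next
    case False
    have "foldr L (i # a) = L i \<circ> foldr L a" by (simp add: comp_def)
    moreover have "foldr L a \<in> generated_algebra (L ` A)" using Cons False by simp
    ultimately show ?thesis using i generated_algebra.mult by metis
  qed
qed simp

lemma nc_poly_in_generated_algebra:
  assumes "nc_poly_without_const N c" "1 \<le> N"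
  shows "nc_poly_eval L c \<in> generated_algebra (L ` {1..N})"
proof -
  let ?A = "generated_algebra (L ` {1..N})"
  have *: "(\<lambda>f k. \<Sum>a\<in>S. c a * foldr L a f k) \<in> ?A" if "finite S" "S \<subseteq> {a. c a \<noteq> 0}" for S
    using that
  proof (induction S rule: finite_induct)
    case empty
    have "L 1 \<in> ?A" using assms(2) by (intro generated_algebra.gen) auto
    then have "(\<lambda>f k. 0 * L 1 f k) \<in> ?A" by (rule generated_algebra.scale)
    then show ?case by simp
  next
    case (insert a S)
    have "foldr L a \<in> ?A"
      using insert.prems assms(1) by (intro foldr_in_generated_algebra) (auto simp: nc_poly_without_const_def)
    then have "(\<lambda>f k. c a * foldr L a f k) \<in> ?A" by (rule generated_algebra.scale)
    then have "(\<lambda>f k. c a * foldr L a f k + (\<Sum>a\<in>S. c a * foldr L a f k)) \<in> ?A"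
      using insert by (intro generated_algebra.add) auto
    then show ?case using insert by simp
  qed
  show ?thesis
    using *[of "{a. c a \<noteq> 0}"] assms(1) by (simp add: nc_poly_eval_def[abs_def] nc_poly_without_const_def)
qed

theorem theorem7p2:
  fixes \<theta> :: real and N :: nat and \<phi> :: "nat \<Rightarrow> complex \<Rightarrow> complex"
  assumes "0 < \<theta>" and "\<theta> < 1" and "1 \<le> N"
    and "\<forall>j\<in>{1..N}. finite_blaschke (\<phi> j)"
    and "\<forall>j\<in>{1..N}. \<phi> j 0 = 0"
    and "\<forall>j\<in>{1..N}. cmod (deriv (\<phi> j) 0) < 1"
  shows "(\<lambda>n. MAX a\<in>words N n. root n (op_norm \<theta> (hyperfunctions0 \<theta>) (koopman \<theta> (word_map \<phi> a))))
           \<longlonglongrightarrow> (MAX j\<in>{1..N}. cmod (deriv (\<phi> j) 0))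
       \<and> ((\<forall>j\<in>{1..N}. deriv (\<phi> j) 0 = 0) \<longrightarrow>
            (\<forall>c. nc_poly_without_const N c \<longrightarrow>
               quasi_nilpotent \<theta> (hyperfunctions0 \<theta>) (nc_poly_eval (\<lambda>j. koopman \<theta> (\<phi> j)) c))
          \<and> (\<forall>T\<in>generated_algebra ((\<lambda>j. koopman \<theta> (\<phi> j)) ` {1..N}).
               quasi_nilpotent \<theta> (hyperfunctions0 \<theta>) T))"
proof (intro conjI impI)
  have \<phi>: "disc_map (\<phi> j)" if "j \<in> {1..N}" for j
    using assms that by (intro disc_map_blaschke) auto
  show "(\<lambda>n. MAX a\<in>words N n. root n (op_norm \<theta> (hyperfunctions0 \<theta>) (koopman \<theta> (word_map \<phi> a))))
           \<longlonglongrightarrow> (MAX j\<in>{1..N}. cmod (deriv (\<phi> j) 0))"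
    using assms by (intro joint_spectral_radius \<phi>) auto
  assume d: "\<forall>j\<in>{1..N}. deriv (\<phi> j) 0 = 0"
  let ?L = "\<lambda>j. koopman \<theta> (\<phi> j)"
  have "superattracting_op \<theta> T" if "T \<in> generated_algebra (?L ` {1..N})" for T
    using that
  proof induction
    case (gen T)
    then show ?case using \<phi> d superattracting_op_koopman[OF assms(1,2)] by auto
  next
    case (add S T)
    then show ?case by (intro superattracting_op_add[OF assms(1,2)])
  next
    case (scale T c)
    then show ?case by (intro superattracting_op_scale[OF assms(1,2)])
  next
    case (mult S T)
    then show ?case by (intro superattracting_op_comp[OF assms(1,2)])
  qed
  then show alg: "\<forall>T\<in>generated_algebra (?L ` {1..N}). quasi_nilpotent \<theta> (hyperfunctions0 \<theta>) T"
    using superattracting_op_quasi_nilpotent[OF assms(1,2)] by blast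
  then show "\<forall>c. nc_poly_without_const N c \<longrightarrow> quasi_nilpotent \<theta> (hyperfunctions0 \<theta>) (nc_poly_eval ?L c)"
    using nc_poly_in_generated_algebra assms(3) by blast
qed

end
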